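(* The threshold for the property $\mathrm{tc}_3(\mathcal{G}(n,p)) \le 3$ is $\left(\log n / n\right)^{1/4}$. That is, there are constants $C, c > 0$ such that if $p > C(\log n/n)^{1/4}$ then w.h.p. $G \sim \mathcal{G}(n,p)$ satisfies $\mathrm{tc}_3(G) \le 3$, and if $p < c(\log n/n)^{1/4}$ then w.h.p. $\mathrm{tc}_3(G) > 3$.
   Context: For a graph $G$ and a positive integer $r$, $\mathrm{tc}_r(G)$ is the minimum integer $m$ such that for every colouring of the edges of $G$ with $r$ colours, there exist $m$ monochromatic trees (equivalently, monochromatic connected components, where a single vertex counts as a component in each colour) whose vertex sets together cover $V(G)$. $\mathcal{G}(n,p)$ is the binomial random graph; "w.h.p." means with probability tending to $1$ as $n \to \infty$. A function $p^*(n)$ is the threshold for an increasing graph property if there are constants $C,c>0$ such that $p > Cp^*(n)$ implies $\mathcal{G}(n,p)$ has the property w.h.p. and $p < cp^*(n)$ implies $\mathcal{G}(n,p)$ does not have the property w.h.p. *)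

theory Defs
  imports "HOL-Probability.Product_PMF"
begin

type_synonym 'a graph = "'a set \<times> 'a set set"

abbreviation verts :: "'a graph \<Rightarrow> 'a set" where "verts \<equiv> fst"
abbreviation edges :: "'a graph \<Rightarrow> 'a set set" where "edges \<equiv> snd"

definition all_edges :: "'a set \<Rightarrow> 'a set set" where
  "all_edges V = {e. e \<subseteq> V \<and> card e = 2}"

definition simple_graph :: "'a graph \<Rightarrow> bool" where
  "simple_graph G \<longleftrightarrow> edges G \<subseteq> all_edges (verts G)"

definition subgraph :: "'a graph \<Rightarrow> 'a graph \<Rightarrow> bool" where
  "subgraph H G \<longleftrightarrow> verts H \<subseteq> verts G \<and> edges H \<subseteq> edges G"

definition connected_graph :: "'a graph \<Rightarrow> bool" where
  "connected_graph G \<longleftrightarrow> verts G \<noteq> {} \<and>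
     (\<forall>u\<in>verts G. \<forall>v\<in>verts G. (u, v) \<in> {(x, y). {x, y} \<in> edges G}\<^sup>*)"

text \<open>A cycle is given by the list of its vertices in cyclic order.\<close>

definition is_cycle :: "'a graph \<Rightarrow> 'a list \<Rightarrow> bool" where
  "is_cycle G xs \<longleftrightarrow> length xs \<ge> 3 \<and> distinct xs \<and>
     (\<forall>i<length xs. {xs ! i, xs ! (Suc i mod length xs)} \<in> edges G)"

definition is_tree :: "'a graph \<Rightarrow> bool" where
  "is_tree T \<longleftrightarrow> simple_graph T \<and> connected_graph T \<and> (\<nexists>xs. is_cycle T xs)"

text \<open>The colours are the numbers below \<open>r\<close>; values of a colouring outside the edge set are
  irrelevant.\<close>

definition edge_colouring :: "nat \<Rightarrow> 'a graph \<Rightarrow> ('a set \<Rightarrow> nat) \<Rightarrow> bool" where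
  "edge_colouring r G c \<longleftrightarrow> (\<forall>e\<in>edges G. c e < r)"

text \<open>A single vertex is a monochromatic tree in every colour.\<close>

definition mono_tree :: "nat \<Rightarrow> 'a graph \<Rightarrow> ('a set \<Rightarrow> nat) \<Rightarrow> 'a graph \<Rightarrow> bool" where
  "mono_tree r G c T \<longleftrightarrow> is_tree T \<and> subgraph T G \<and> (\<exists>i<r. \<forall>e\<in>edges T. c e = i)"

text \<open>The \<open>m\<close> trees may have different colours, may overlap, and may repeat. For finite \<open>G\<close> and
  \<open>r > 0\<close> the minimum is attained, since single vertices are allowed as trees.\<close>

definition tc :: "nat \<Rightarrow> 'a graph \<Rightarrow> nat" where
  "tc r G = (LEAST m. \<forall>c. edge_colouring r G c \<longrightarrow>
     (\<exists>T. (\<forall>j<m. mono_tree r G c (T j)) \<and> (\<Union>j<m. verts (T j)) = verts G))"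

text \<open>The binomial random graph on the vertex set \<open>{..<n}\<close>, for \<open>0 \<le> p \<le> 1\<close>: each possible edge is
  present independently with probability \<open>p\<close>.\<close>

definition gnp :: "nat \<Rightarrow> real \<Rightarrow> nat graph pmf" where
  "gnp n p = map_pmf (\<lambda>f. ({..<n}, {e \<in> all_edges {..<n}. f e}))
     (Pi_pmf (all_edges {..<n}) False (\<lambda>_. bernoulli_pmf p))"

definition whp_gnp :: "(nat \<Rightarrow> real) \<Rightarrow> (nat graph \<Rightarrow> bool) \<Rightarrow> bool" where
  "whp_gnp p Q \<longleftrightarrow> (\<lambda>n. measure_pmf.prob (gnp n (p n)) {G. Q G}) \<longlonglongrightarrow> 1"

text \<open>The inequalities between \<open>p\<close> and \<open>pstar\<close> are required only for all large \<open>n\<close>: since \<open>p n \<le> 1\<close>,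
  demanding \<open>p n > C * pstar n\<close> for every \<open>n\<close> could be unsatisfiable because of small \<open>n\<close>, making
  the first condition vacuous. The notion is meant for increasing properties \<open>Q\<close>.\<close>

definition is_threshold :: "(nat graph \<Rightarrow> bool) \<Rightarrow> (nat \<Rightarrow> real) \<Rightarrow> bool" where
  "is_threshold Q pstar \<longleftrightarrow> (\<exists>C>0. \<exists>c>0. \<forall>p. (\<forall>n. 0 \<le> p n \<and> p n \<le> 1) \<longrightarrow>
     ((\<forall>\<^sub>F n in sequentially. p n > C * pstar n) \<longrightarrow> whp_gnp p Q) \<and>
     ((\<forall>\<^sub>F n in sequentially. p n < c * pstar n) \<longrightarrow> whp_gnp p (\<lambda>G. \<not> Q G)))"

end

theory Submission
  imports Defs "HOL-Real_Asymp.Real_Asymp"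
begin

text \<open>Label every vertex, in each of the three colours, by its monochromatic component; adjacent vertices
  share a label, and three monochromatic trees cover iff three labels do.

  For large \<open>p\<close>, any two sets of order \<open>ln n / p\<close> are joined by an edge, so label patterns that occur on
  that many vertices pairwise intersect. A 3-partite intersecting family is a star (one common label),
  lies in a majority family (two out of three fixed labels) or is a truncated Fano plane, and hence so
  are the label triples of all but \<open>O(ln n / p)\<close> vertices. As three vertices have more common neighbours
  than that, a star forces the triples avoiding its centre to look like a bipartite graph without a
  3-matching, and Koenig's theorem gives two more labels. In the other two cases, if no three labels
  cover, the exceptional vertices are the union of four nonempty sets such that every vertex adjacent to
  all four is exceptional itself; this contradicts expansion, since \<open>n p\<^sup>4\<close> exceeds a large multiple of
  \<open>ln n\<close>.

  For small \<open>p\<close>, there are four independent vertices without a common neighbour. Every other vertex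
  misses one of them, and the colouring can be chosen such that the four lie in distinct components in
  each colour.\<close>

section \<open>Monochromatic trees and components\<close>

text \<open>The exponent comes from four-wise common neighbours: four fixed vertices have about
  \<open>n * p ^ 4\<close> of them, to be compared with \<open>ln n\<close>. Three vertices have
  about \<open>n * p ^ 3\<close>, which at the threshold has the order \<open>ln n / p\<close> of
  the exceptional set and exceeds it if the constant is large; the star case needs no more. The
  obstacle lies in the other two cases: the four sets may be singletons, and the few common
  neighbours of four vertices could all be exceptional. So the comparison there is with the actual
  size of the union: one vertex from each of three sets, together with the largest set
  \<open>M\<close>, has more than \<open>4 * card M\<close> common neighbours, too many for the
  union. A pattern also needs a value for colours in which no label is frequent on the given set;
  such a colour never makes two large sets meet. In the sparse case a suitable quadruple is sought
  among polynomially many disjoint ones, few enough that no edge lies among all their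
  vertices.\<close>

lemma connected_remove_cycle_edge:
  assumes con: "connected_graph (V, F)" and cyc: "is_cycle (V, F) xs"
  shows "connected_graph (V, F - {{xs ! 0, xs ! 1}})"
proof -
  let ?e = "{xs ! 0, xs ! 1}"
  let ?R = "{(x, y). {x, y} \<in> F}" and ?R' = "{(x, y). {x, y} \<in> F - {?e}}"
  have len: "length xs \<ge> 3" and dist: "distinct xs"
    and ed: "\<And>i. i < length xs \<Longrightarrow> {xs ! i, xs ! (Suc i mod length xs)} \<in> F"
    using cyc by (auto simp: is_cycle_def)
  have symR': "sym ?R'" by (auto simp: sym_def insert_commute)
  have next_edge: "(xs ! i, xs ! (Suc i mod length xs)) \<in> ?R'" if i: "0 < i" "i < length xs" for i
  proof -
    \<comment> \<open>This needs length at least 3: with two vertices only, the step back from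
      \<open>xs ! 1\<close> to \<open>xs ! 0\<close> would be the deleted edge itself.\<close>
    have "{xs ! i, xs ! (Suc i mod length xs)} \<noteq> ?e"
    proof
      assume eq: "{xs ! i, xs ! (Suc i mod length xs)} = ?e"
      have nth: "xs ! a = xs ! b \<longleftrightarrow> a = b" if "a < length xs" "b < length xs" for a b
        using dist that by (simp add: nth_eq_iff_index_eq)
      have "xs ! i = xs ! 0 \<or> xs ! i = xs ! 1" using eq by blast
      then have "i = 1" using i len nth [of i 0] nth [of i 1] by linarith
      moreover have "Suc 1 mod length xs = 2" using len by simp
      ultimately have "{xs ! 1, xs ! 2} = ?e" using eq by simp
      then have "xs ! 2 = xs ! 0 \<or> xs ! 2 = xs ! 1" by blast
      moreover have "0 < length xs" "1 < length xs" "2 < length xs" using len by linarith+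
      ultimately show False using nth [of 2 0] nth [of 2 1] by simp
    qed
    then show ?thesis using ed [OF i(2)] by auto
  qed
  have path: "k < length xs \<Longrightarrow> (xs ! 1, xs ! k) \<in> ?R'\<^sup>*" if "1 \<le> k" for k
    using that
  proof (induction k rule: dec_induct)
    case (step k)
    have "(xs ! k, xs ! Suc k) \<in> ?R'" using next_edge [of k] step by simp
    then show ?case using step by (simp add: rtrancl.rtrancl_into_rtrancl)
  qed simp
  have "Suc (length xs - 1) = length xs" "length xs - 1 < length xs" "0 < length xs - 1"
    using len by linarith+
  moreover from this have "Suc (length xs - 1) mod length xs = 0" by simp
  ultimately have "(xs ! (length xs - 1), xs ! 0) \<in> ?R'" using next_edge [of "length xs - 1"] by metis
  moreover have "(xs ! 1, xs ! (length xs - 1)) \<in> ?R'\<^sup>*"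
    using len by (intro path) linarith+
  ultimately have 10: "(xs ! 1, xs ! 0) \<in> ?R'\<^sup>*" by (rule rtrancl_into_rtrancl [rotated])
  then have 01: "(xs ! 0, xs ! 1) \<in> ?R'\<^sup>*" using sym_rtrancl [OF symR'] by (rule symD [rotated])
  have "?R \<subseteq> ?R'\<^sup>*"
  proof clarify
    fix x y assume "{x, y} \<in> F"
    then show "(x, y) \<in> ?R'\<^sup>*"
    proof (cases "{x, y} = ?e")
      case True
      then show ?thesis using 01 10 by (auto simp: doubleton_eq_iff)
    next
      case False
      then show ?thesis using \<open>{x, y} \<in> F\<close> by (intro r_into_rtrancl) auto
    qed
  qed
  then have "?R\<^sup>* \<subseteq> ?R'\<^sup>*" by (metis rtrancl_idemp rtrancl_mono)
  then show ?thesis using con unfolding connected_graph_def by auto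
qed

text \<open>A connected edge set of least size is acyclic, since deleting an edge of a cycle keeps
  it connected.\<close>

lemma spanning_tree_exists:
  assumes fin: "finite E" and simple: "simple_graph (V, E)" and con: "connected_graph (V, E)"
  shows "\<exists>F\<subseteq>E. is_tree (V, F)"
proof -
  define good where "good F \<longleftrightarrow> F \<subseteq> E \<and> connected_graph (V, F)" for F
  have "good E" using con by (simp add: good_def)
  then obtain F where F: "good F" and min: "\<And>F'. good F' \<Longrightarrow> card F \<le> card F'"
    using exists_least_iff [of "\<lambda>k. \<exists>F. good F \<and> card F = k"] by (metis not_less)
  have "\<not> is_cycle (V, F) xs" for xs
  proof
    assume cyc: "is_cycle (V, F) xs"
    let ?e = "{xs ! 0, xs ! 1}"
    have "good (F - {?e})" using connected_remove_cycle_edge [OF _ cyc] F by (auto simp: good_def)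
    moreover have "?e \<in> F" using cyc by (auto simp: is_cycle_def dest!: spec [of _ 0])
    then have "card (F - {?e}) < card F"
      using F fin finite_subset unfolding good_def by (intro psubset_card_mono) auto
    ultimately show False using min by (meson not_le)
  qed
  then have "is_tree (V, F)" using F simple by (auto simp: is_tree_def good_def simple_graph_def)
  then show ?thesis using F by (auto simp: good_def)
qed

text \<open>The component itself, as a vertex set, later serves as the label. The reflexive closure
  puts every vertex into its own component in every colour, even if it has no edge of that
  colour.\<close>

definition mono_comp :: "'a graph \<Rightarrow> ('a set \<Rightarrow> nat) \<Rightarrow> nat \<Rightarrow> 'a \<Rightarrow> 'a set" where
  "mono_comp G c i v = {w. (v, w) \<in> {(x, y). {x, y} \<in> edges G \<and> c {x, y} = i}\<^sup>*}"

lemma mono_comp_eq_if_edge: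
  assumes "{x, y} \<in> edges G"
  shows "mono_comp G c (c {x, y}) x = mono_comp G c (c {x, y}) y"
proof -
  let ?R = "{(u, v). {u, v} \<in> edges G \<and> c {u, v} = c {x, y}}"
  have "(x, y) \<in> ?R" "(y, x) \<in> ?R" using assms by (auto simp: insert_commute)
  then show ?thesis unfolding mono_comp_def by (auto intro: converse_rtrancl_into_rtrancl)
qed

lemma mono_tree_covers_comp:
  assumes fin: "finite (verts G)" and simple: "simple_graph G" and "i < r" and v: "v \<in> verts G"
  shows "\<exists>T. mono_tree r G c T \<and> {w\<in>verts G. mono_comp G c i w = mono_comp G c i v} \<subseteq> verts T"
proof -
  let ?R = "{(x, y). {x, y} \<in> edges G \<and> c {x, y} = i}"
  define C where "C = mono_comp G c i v"
  define E where "E = {e\<in>edges G. c e = i \<and> e \<subseteq> C}"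
  have symR: "sym ?R" by (auto simp: sym_def insert_commute)
  have edge: "{x, y} \<in> edges G \<Longrightarrow> x \<in> verts G \<and> y \<in> verts G" for x y
    using simple by (auto simp: simple_graph_def all_edges_def)
  have "w \<in> verts G" if "(v, w) \<in> ?R\<^sup>*" for w
    using that by (induction rule: rtrancl_induct) (use v edge in auto)
  then have CV: "C \<subseteq> verts G" by (auto simp: C_def mono_comp_def)
  have conv: "(v, w) \<in> {(x, y). {x, y} \<in> E}\<^sup>*" if "(v, w) \<in> ?R\<^sup>*" for w
    using that
  proof (induction rule: rtrancl_induct)
    case (step y z)
    then have "y \<in> C" "z \<in> C" by (auto simp: C_def mono_comp_def intro: rtrancl_into_rtrancl)
    then have "(y, z) \<in> {(x, y). {x, y} \<in> E}" using step by (auto simp: E_def)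
    then show ?case using step by (meson rtrancl_into_rtrancl)
  qed simp
  have "sym {(x, y). {x, y} \<in> E}" by (auto simp: sym_def insert_commute)
  then have symE: "sym ({(x, y). {x, y} \<in> E}\<^sup>*)" by (rule sym_rtrancl)
  have "v \<in> C" by (simp add: C_def mono_comp_def)
  then have "C \<noteq> {}" by blast
  have "\<forall>a\<in>C. \<forall>b\<in>C. (a, b) \<in> {(x, y). {x, y} \<in> E}\<^sup>*"
  proof (intro ballI)
    fix a b assume that: "a \<in> C" "b \<in> C"
    have va: "(v, a) \<in> {(x, y). {x, y} \<in> E}\<^sup>*" and vb: "(v, b) \<in> {(x, y). {x, y} \<in> E}\<^sup>*"
      using that conv by (auto simp: C_def mono_comp_def)
    show "(a, b) \<in> {(x, y). {x, y} \<in> E}\<^sup>*" by (rule rtrancl_trans [OF symD [OF symE va] vb])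
  qed
  with \<open>C \<noteq> {}\<close> have con: "connected_graph (C, E)"
    unfolding connected_graph_def fst_conv snd_conv by (rule conjI)
  have sE: "simple_graph (C, E)" using simple by (auto simp: simple_graph_def all_edges_def E_def)
  have "finite (edges G)"
  proof (rule finite_subset)
    show "edges G \<subseteq> Pow (verts G)" using simple by (auto simp: simple_graph_def all_edges_def)
  qed (use fin in simp)
  then have "finite E" by (simp add: E_def)
  then obtain F where F: "F \<subseteq> E" "is_tree (C, F)" using spanning_tree_exists [OF _ sE con] by blast
  have "mono_tree r G c (C, F)"
    using F CV \<open>i < r\<close> unfolding mono_tree_def subgraph_def E_def by auto
  moreover have "{w\<in>verts G. mono_comp G c i w = mono_comp G c i v} \<subseteq> C"
    unfolding C_def by (auto simp: mono_comp_def)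
  ultimately show ?thesis by (intro exI [of _ "(C, F)"]) auto
qed

lemma tc_3_le_3:
  assumes fin: "finite (verts G)" "verts G \<noteq> {}" and simple: "simple_graph G"
    and cover: "\<And>c. edge_colouring 3 G c \<Longrightarrow> \<exists>i<3. \<exists>j<3. \<exists>k<3. \<exists>a b d. \<forall>v\<in>verts G.
      mono_comp G c i v = a \<or> mono_comp G c j v = b \<or> mono_comp G c k v = d"
  shows "tc 3 G \<le> 3"
  unfolding tc_def
proof (rule Least_le, intro allI impI)
  fix c assume col: "edge_colouring 3 G c"
  obtain i j k a b d where ijk: "i < 3" "j < 3" "k < 3" and cov: "\<forall>v\<in>verts G.
      mono_comp G c i v = a \<or> mono_comp G c j v = b \<or> mono_comp G c k v = d"
    using cover [OF col] by (elim exE conjE) (rule that)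
  have tree: "\<exists>T. mono_tree 3 G c T \<and> {w\<in>verts G. mono_comp G c i w = a} \<subseteq> verts T" if "i < 3" for i a
  proof (cases "\<exists>v\<in>verts G. mono_comp G c i v = a")
    case True
    then show ?thesis using mono_tree_covers_comp [OF fin(1) simple that] by blast
  next
    \<comment> \<open>\<open>tc\<close> asks for exactly three trees, so a label that no vertex
      carries still gets one, grown from any vertex of the nonempty graph.\<close>
    case False
    obtain v where "v \<in> verts G" using fin by auto
    then show ?thesis using mono_tree_covers_comp [OF fin(1) simple that, of v c] False by blast
  qed
  obtain T1 T2 T3 where T: "mono_tree 3 G c T1" "mono_tree 3 G c T2" "mono_tree 3 G c T3"
    "{w\<in>verts G. mono_comp G c i w = a} \<subseteq> verts T1" "{w\<in>verts G. mono_comp G c j w = b} \<subseteq> verts T2"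
    "{w\<in>verts G. mono_comp G c k w = d} \<subseteq> verts T3"
    using tree [OF ijk(1), of a] tree [OF ijk(2), of b] tree [OF ijk(3), of d] by blast
  define T where "T = (\<lambda>j :: nat. if j = 0 then T1 else if j = 1 then T2 else T3 :: 'a graph)"
  have three: "{..<3} = {0, 1, 2 :: nat}" by auto
  have "\<forall>j<3. mono_tree 3 G c (T j)" using T by (auto simp: T_def)
  moreover have "(\<Union>j<3. verts (T j)) = verts G"
  proof
    have "verts T' \<subseteq> verts G" if "mono_tree 3 G c T'" for T' using that by (auto simp: mono_tree_def subgraph_def)
    then show "(\<Union>j<3. verts (T j)) \<subseteq> verts G" using \<open>\<forall>j<3. _\<close> by blast
    show "verts G \<subseteq> (\<Union>j<3. verts (T j))" using T cov unfolding three by (auto simp: T_def)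
  qed
  ultimately show "\<exists>T. (\<forall>j<3::nat. mono_tree 3 G c (T j)) \<and> (\<Union>j<3::nat. verts (T j)) = verts G" by blast
qed

text \<open>On a monochromatic tree of colour \<open>i\<close> the label \<open>l i\<close> is
  constant, so by injectivity the tree holds at most one vertex of \<open>X\<close>, and
  \<open>m\<close> trees cannot cover \<open>X\<close>. The labels may be coarser than components:
  being constant along edges of their colour suffices.\<close>

lemma not_tc_le:
  assumes fin: "finite (verts G)" and "0 < r"
    and col: "edge_colouring r G c"
    and lab: "\<And>x y. {x, y} \<in> edges G \<Longrightarrow> l (c {x, y}) x = l (c {x, y}) y"
    and X: "X \<subseteq> verts G" "m < card X" and inj: "\<And>i. i < r \<Longrightarrow> inj_on (l i) X"
  shows "\<not> tc r G \<le> m"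
proof
  assume "tc r G \<le> m"
  define Q where "Q k \<longleftrightarrow> (\<forall>c. edge_colouring r G c \<longrightarrow>
     (\<exists>T. (\<forall>j<k. mono_tree r G c (T j)) \<and> (\<Union>j<k. verts (T j)) = verts G))" for k :: nat
  \<comment> \<open>A \<open>LEAST\<close> says nothing until some number of trees is known to
    suffice; one-vertex trees supply \<open>card (verts G)\<close>.\<close>
  have "Q (card (verts G))"
  proof -
    obtain f where f: "bij_betw f {0..<card (verts G)} (verts G)" using ex_bij_betw_nat_finite [OF fin] by blast
    have "\<not> is_cycle ({v}, {}) xs" for v :: 'a and xs
      by (auto simp: is_cycle_def intro!: exI [of _ 0])
    then have "mono_tree r G c ({v}, {})" if "v \<in> verts G" for c v
      using that \<open>0 < r\<close>
      by (auto simp: mono_tree_def is_tree_def simple_graph_def connected_graph_def subgraph_def)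
    moreover have "(\<Union>j<card (verts G). {f j}) = verts G"
      using f by (simp add: bij_betw_def atLeast0LessThan UNION_singleton_eq_range)
    ultimately show ?thesis unfolding Q_def
      by (intro allI impI exI [of _ "\<lambda>j. ({f j}, {})"]) auto
  qed
  then have "Q (tc r G)" unfolding Q_def tc_def by (rule LeastI)
  then obtain T where T: "\<And>j. j < tc r G \<Longrightarrow> mono_tree r G c (T j)" "(\<Union>j<tc r G. verts (T j)) = verts G"
    using col unfolding Q_def by blast
  then have "\<forall>x\<in>X. \<exists>j<tc r G. x \<in> verts (T j)" using X(1) by blast
  then obtain f where f: "\<And>x. x \<in> X \<Longrightarrow> f x < tc r G \<and> x \<in> verts (T (f x))" by metis
  have "f ` X \<subseteq> {..<tc r G}" using f by auto
  then have "card (f ` X) \<le> card {..<tc r G}" by (intro card_mono) simp_all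
  then have "\<not> inj_on f X" using X(2) \<open>tc r G \<le> m\<close> card_image [of f X] by fastforce
  then obtain x y where xy: "x \<in> X" "y \<in> X" "x \<noteq> y" "f x = f y" by (auto simp: inj_on_def)
  let ?T = "T (f x)"
  obtain i where i: "i < r" "\<And>e. e \<in> edges ?T \<Longrightarrow> c e = i" and con: "connected_graph ?T" and sub: "subgraph ?T G"
    using T(1) [of "f x"] f xy(1) by (auto simp: mono_tree_def is_tree_def)
  have "(x, y) \<in> {(x, y). {x, y} \<in> edges ?T}\<^sup>*" using con f xy by (metis connected_graph_def)
  then have "l i x = l i y"
  proof (induction rule: rtrancl_induct)
    case (step y z)
    then have "{y, z} \<in> edges G" "c {y, z} = i" using sub i by (auto simp: subgraph_def)
    then show ?case using lab [of y z] step by simp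
  qed simp
  then show False using inj [OF i(1)] xy by (auto simp: inj_on_def)
qed

section \<open>Label triples of large sets of vertices\<close>

text \<open>\<open>None\<close> stands for a colour in which \<open>X\<close> is so spread out that
  discarding any one label costs fewer than \<open>s\<close> vertices; such a colour can be
  separated from every other pattern. With \<open>Some\<close> for constant colours, the pattern of
  a large set is a triple of options.\<close>

definition hom_type :: "(nat \<Rightarrow> 'v \<Rightarrow> 'l) \<Rightarrow> nat \<Rightarrow> 'v set \<Rightarrow> nat \<Rightarrow> 'l option \<Rightarrow> bool" where
  "hom_type lab s X i a \<longleftrightarrow> (case a of Some l \<Rightarrow> \<forall>x\<in>X. lab i x = l
      | None \<Rightarrow> \<forall>l. card {x\<in>X. lab i x = l} < s)"

lemma hom_type_subset:
  assumes "hom_type lab s X i a" "Y \<subseteq> X" "finite X"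
  shows "hom_type lab s Y i a"
proof (cases a)
  case None
  have "card {x\<in>Y. lab i x = l} < s" for l
  proof -
    have "card {x\<in>Y. lab i x = l} \<le> card {x\<in>X. lab i x = l}"
      using assms by (intro card_mono) auto
    also have "\<dots> < s" using assms None by (auto simp: hom_type_def)
    finally show ?thesis .
  qed
  then show ?thesis using None by (simp add: hom_type_def)
qed (use assms in \<open>auto simp: hom_type_def\<close>)

text \<open>If one set is constant, drop its label from the other. If both are spread, cut the
  labels in two so that one half holds enough of one set and the other half enough of the
  other.\<close>

lemma separate_colour:
  fixes lab :: "nat \<Rightarrow> 'v \<Rightarrow> 'l"
  assumes fin: "finite X" "finite Y"
    and big: "3 * s \<le> card X" "3 * t \<le> card Y"
    and hom: "hom_type lab s X i a" "hom_type lab t Y i b"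
    and ne: "a \<noteq> b \<or> a = None"
  shows "\<exists>X'\<subseteq>X. \<exists>Y'\<subseteq>Y. s \<le> card X' \<and> t \<le> card Y' \<and> lab i ` X' \<inter> lab i ` Y' = {}"
proof (cases a)
  case (Some l)
  let ?Y' = "{y\<in>Y. lab i y \<noteq> l}"
  have "t \<le> card ?Y'"
  proof (cases b)
    case None
    have "card {y\<in>Y. lab i y = l} < t" using hom None by (auto simp: hom_type_def)
    moreover have "card Y = card {y\<in>Y. lab i y = l} + card ?Y'"
      using fin by (subst card_Un_disjoint [symmetric]) (auto intro!: arg_cong [where f = card])
    ultimately show ?thesis using big by linarith
  next
    case (Some k)
    then have "?Y' = Y" using hom ne \<open>a = Some l\<close> by (auto simp: hom_type_def)
    then show ?thesis using big by simp
  qed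
  moreover have "lab i ` X \<inter> lab i ` ?Y' = {}"
    using hom Some by (auto simp: hom_type_def)
  ultimately show ?thesis using big by (intro exI [of _ X] conjI exI [of _ ?Y']) auto
next
  case None
  note hX = None
  show ?thesis
  proof (cases b)
    case (Some l)
    let ?X' = "{y\<in>X. lab i y \<noteq> l}"
    have "card {y\<in>X. lab i y = l} < s" using hom None by (auto simp: hom_type_def)
    moreover have "card X = card {y\<in>X. lab i y = l} + card ?X'"
      using fin by (subst card_Un_disjoint [symmetric]) (auto intro!: arg_cong [where f = card])
    ultimately have "s \<le> card ?X'" using big by linarith
    moreover have "lab i ` ?X' \<inter> lab i ` Y = {}"
      using hom Some by (auto simp: hom_type_def)
    ultimately show ?thesis using big by (intro exI [of _ ?X'] conjI exI [of _ Y]) auto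
  next
    case None
    let ?x = "\<lambda>S. {x\<in>X. lab i x \<in> S}" and ?y = "\<lambda>S. {y\<in>Y. lab i y \<in> S}"
    \<comment> \<open>A smallest label set that is heavy for \<open>X\<close> or for
      \<open>Y\<close>. Without one of its labels it is light for both, and a single label weighs
      less than \<open>s\<close> and \<open>t\<close>; so it holds less than \<open>2 * s\<close> of
      \<open>X\<close> and less than \<open>2 * t\<close> of \<open>Y\<close>. Hence the complement
      is heavy for both, and one set is kept inside, the other outside.\<close>
    define good where "good S \<longleftrightarrow> finite S \<and> (s \<le> card (?x S) \<or> t \<le> card (?y S))" for S
    have smallX: "card {x\<in>X. lab i x = l} < s" for l using hom hX by (auto simp: hom_type_def)
    have smallY: "card {x\<in>Y. lab i x = l} < t" for l using hom None by (auto simp: hom_type_def)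
    have "?x (lab i ` (X \<union> Y)) = X" by auto
    then have "good (lab i ` (X \<union> Y))" using fin big unfolding good_def by auto
    then obtain S where S: "good S" and min: "\<And>S'. good S' \<Longrightarrow> card S \<le> card S'"
      using exists_least_iff [of "\<lambda>k. \<exists>S. good S \<and> card S = k"] by (metis not_less)
    have "S \<noteq> {}"
    proof
      assume "S = {}"
      then show False using S smallX [of undefined] smallY [of undefined] unfolding good_def by simp
    qed
    then obtain l where l: "l \<in> S" by auto
    have "card (S - {l}) < card S" using l S by (intro psubset_card_mono) (auto simp: good_def)
    then have "\<not> good (S - {l})" using min [of "S - {l}"] by linarith
    then have small: "card (?x (S - {l})) < s" "card (?y (S - {l})) < t"
      using S unfolding good_def not_le by (meson finite_Diff not_le)+
    have "card (?x S) \<le> card (?x (S - {l}) \<union> {x\<in>X. lab i x = l})"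
      using fin by (intro card_mono) auto
    also have "\<dots> \<le> card (?x (S - {l})) + card {x\<in>X. lab i x = l}" by (rule card_Un_le)
    finally have x2: "card (?x S) < 2 * s" using small(1) smallX [of l] by linarith
    have "card (?y S) \<le> card (?y (S - {l}) \<union> {x\<in>Y. lab i x = l})"
      using fin by (intro card_mono) auto
    also have "\<dots> \<le> card (?y (S - {l})) + card {x\<in>Y. lab i x = l}" by (rule card_Un_le)
    finally have y2: "card (?y S) < 2 * t" using small(2) smallY [of l] by linarith
    have cX: "card X = card (?x S) + card (?x (- S))"
      using fin by (subst card_Un_disjoint [symmetric]) (auto intro!: arg_cong [where f = card])
    have cY: "card Y = card (?y S) + card (?y (- S))"
      using fin by (subst card_Un_disjoint [symmetric]) (auto intro!: arg_cong [where f = card])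
    show ?thesis
    proof (cases "s \<le> card (?x S)")
      case True
      moreover have "t \<le> card (?y (- S))" using cY y2 big by linarith
      moreover have "lab i ` ?x S \<inter> lab i ` ?y (- S) = {}" by auto
      ultimately show ?thesis by (intro exI [of _ "?x S"] conjI exI [of _ "?y (- S)"]) auto
    next
      case False
      then have "t \<le> card (?y S)" using S by (auto simp: good_def)
      moreover have "s \<le> card (?x (- S))" using cX x2 big by linarith
      moreover have "lab i ` ?x (- S) \<inter> lab i ` ?y S = {}" by auto
      ultimately show ?thesis by (intro exI [of _ "?x (- S)"] conjI exI [of _ "?y S"]) auto
    qed
  qed
qed

text \<open>One colour after another, each at the cost of a factor 3 in both sizes;
  \<open>hom_type\<close> with fixed \<open>s\<close> survives the passage to subsets.\<close>

lemma separate_colours: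
  fixes lab :: "nat \<Rightarrow> 'v \<Rightarrow> 'l"
  assumes fin: "finite X" "finite Y"
    and big: "3 ^ k * s \<le> card X" "3 ^ k * t \<le> card Y"
    and hom: "\<And>i. i < k \<Longrightarrow> hom_type lab s X i (f i)" "\<And>i. i < k \<Longrightarrow> hom_type lab t Y i (g i)"
    and ne: "\<And>i. i < k \<Longrightarrow> f i \<noteq> g i \<or> f i = None"
  shows "\<exists>X'\<subseteq>X. \<exists>Y'\<subseteq>Y. s \<le> card X' \<and> t \<le> card Y' \<and> (\<forall>i<k. lab i ` X' \<inter> lab i ` Y' = {})"
  using assms
proof (induction k arbitrary: X Y)
  case 0
  then show ?case by (intro exI [of _ X] conjI exI [of _ Y]) auto
next
  case (Suc k)
  have hX: "hom_type lab (3 ^ k * s) X k (f k)" and hY: "hom_type lab (3 ^ k * t) Y k (g k)"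
    using Suc.prems(5) [of k] Suc.prems(6) [of k]
    by (fastforce simp: hom_type_def split: option.splits elim: less_le_trans)+
  have b: "3 * (3 ^ k * s) \<le> card X" "3 * (3 ^ k * t) \<le> card Y" using Suc.prems by auto
  obtain X1 Y1 where 1: "X1 \<subseteq> X" "Y1 \<subseteq> Y" "3 ^ k * s \<le> card X1" "3 ^ k * t \<le> card Y1"
    "lab k ` X1 \<inter> lab k ` Y1 = {}"
    using separate_colour [OF Suc.prems(1,2) b hX hY] Suc.prems(7) [of k] by auto
  have "\<exists>X'\<subseteq>X1. \<exists>Y'\<subseteq>Y1. s \<le> card X' \<and> t \<le> card Y' \<and> (\<forall>i<k. lab i ` X' \<inter> lab i ` Y' = {})"
  proof (rule Suc.IH)
    show "finite X1" "finite Y1" using 1 Suc.prems(1,2) finite_subset by auto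
    show "hom_type lab s X1 i (f i)" if "i < k" for i
      using Suc.prems(5) [of i] that 1 Suc.prems(1) by (auto intro: hom_type_subset)
    show "hom_type lab t Y1 i (g i)" if "i < k" for i
      using Suc.prems(6) [of i] that 1 Suc.prems(2) by (auto intro: hom_type_subset)
  qed (use 1 Suc.prems in auto)
  then obtain X' Y' where 2: "X' \<subseteq> X1" "Y' \<subseteq> Y1" "s \<le> card X'" "t \<le> card Y'"
     "\<forall>i<k. lab i ` X' \<inter> lab i ` Y' = {}" by auto
  have "lab k ` X' \<inter> lab k ` Y' = {}" using 1 2 by blast
  then show ?case using 1 2 by (intro exI [of _ X'] conjI exI [of _ Y']) (auto simp: less_Suc_eq)
qed

text \<open>\<open>J\<close> collects the colours already made constant, and \<open>k\<close> counts
  the others. Either a further colour has a label class of at least a 27th of the size bound, and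
  one restricts to it, or all remaining colours are spread with \<open>s\<close> a 27th of the
  bound. This 27 is the \<open>3 ^ 3\<close> of \<open>separate_colours\<close>; the start
  \<open>k = 3\<close> produces the \<open>27 ^ 4\<close> of the later lemmas.\<close>

lemma homogeneous_subset:
  fixes lab :: "nat \<Rightarrow> 'v \<Rightarrow> 'l"
  assumes "finite X" "27 ^ (k + 1) * L \<le> card X" "J \<subseteq> {..<3}" "card J = 3 - k" "k \<le> 3"
    and "\<And>i. i \<in> J \<Longrightarrow> \<exists>l. \<forall>x\<in>X. lab i x = l"
  shows "\<exists>Y\<subseteq>X. \<exists>s\<ge>L. \<exists>f. 27 * s \<le> card Y \<and> (\<forall>i<3. hom_type lab s Y i (f i))"
  using assms
proof (induction k arbitrary: X J)
  case 0
  then have "J = {..<3}" by (intro card_subset_eq) auto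
  then have "\<exists>l. \<forall>x\<in>X. lab i x = l" if "i < 3" for i using 0(6) that by blast
  then obtain f where "\<And>i. i < 3 \<Longrightarrow> \<forall>x\<in>X. lab i x = f i" by metis
  then have "\<forall>i<3. hom_type lab L X i (Some (f i))" by (simp add: hom_type_def)
  then show ?case using 0(2)
    by (intro exI [of _ X] exI [of _ L] conjI exI [of _ "\<lambda>i. Some (f i)"]) auto
next
  case (Suc k)
  have finJ: "finite J" using Suc.prems(3) finite_subset by auto
  show ?case
  proof (cases "\<exists>i<3. i \<notin> J \<and> (\<exists>l. 27 ^ (k + 1) * L \<le> card {x\<in>X. lab i x = l})")
    case True
    then obtain i l where i: "i < 3" "i \<notin> J" "27 ^ (k + 1) * L \<le> card {x\<in>X. lab i x = l}" by auto
    have "\<exists>Y\<subseteq>{x\<in>X. lab i x = l}. \<exists>s\<ge>L. \<exists>f. 27 * s \<le> card Y \<and> (\<forall>i<3. hom_type lab s Y i (f i))"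
    proof (rule Suc.IH [of _ "insert i J"])
      show "\<exists>l'. \<forall>x\<in>{x\<in>X. lab i x = l}. lab j x = l'" if "j \<in> insert i J" for j
        using that Suc.prems(6) [of j] by blast
      show "finite {x\<in>X. lab i x = l}" using Suc.prems(1) by simp
      show "insert i J \<subseteq> {..<3}" using i Suc.prems(3) by simp
      show "card (insert i J) = 3 - k" using i Suc.prems(4,5) finJ by simp
      show "k \<le> 3" using Suc.prems(5) by simp
    qed (rule i(3))
    then obtain Y s f where "Y \<subseteq> {x\<in>X. lab i x = l}" "L \<le> s" "27 * s \<le> card Y"
      "\<forall>i<3. hom_type lab s Y i (f i)" by blast
    then show ?thesis
      by (intro exI [of _ Y] exI [of _ s] conjI exI [of _ f]) auto
  next
    case False
    note rare = False
    define c where "c i = (SOME l. \<forall>x\<in>X. lab i x = l)" for i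
    define f where "f i = (if i \<in> J then Some (c i) else None)" for i
    have "hom_type lab (27 ^ (k + 1) * L) X i (f i)" if "i < 3" for i
    proof (cases "i \<in> J")
      case True
      have "\<forall>x\<in>X. lab i x = c i" unfolding c_def by (rule someI_ex [OF Suc.prems(6) [OF True]])
      then show ?thesis using True by (simp add: hom_type_def f_def)
    next
      case False
      then have "\<forall>l. \<not> 27 ^ (k + 1) * L \<le> card {x\<in>X. lab i x = l}" using that rare by blast
      then show ?thesis using False by (simp add: hom_type_def f_def not_le)
    qed
    then show ?thesis using Suc.prems(2)
      by (intro exI [of _ X] exI [of _ "27 ^ (k + 1) * L"] conjI exI [of _ f]) simp_all
  qed
qed

section \<open>Intersecting families of label patterns\<close>

definition agree :: "'a option \<Rightarrow> 'a option \<Rightarrow> bool" where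
  "agree x y \<longleftrightarrow> x = y \<and> x \<noteq> None"

text \<open>If neither label is common to all, some pattern has \<open>a\<close> but not
  \<open>b\<close> and another has \<open>b\<close> but not \<open>a\<close>. These two can meet
  only in colour \<open>k\<close>, and their common label there is the third majority label.\<close>

lemma intersecting_star_or_majority:
  assumes P: "\<And>f g. f \<in> P \<Longrightarrow> g \<in> P \<Longrightarrow> agree (f i) (g i) \<or> agree (f j) (g j) \<or> agree (f k) (g k)"
    and cov: "\<And>f. f \<in> P \<Longrightarrow> f i = Some a \<or> f j = Some b"
  shows "(\<forall>f\<in>P. f i = Some a) \<or> (\<forall>f\<in>P. f j = Some b) \<or>
    (\<exists>c. \<forall>f\<in>P. f i = Some a \<and> f j = Some b \<or> f i = Some a \<and> f k = Some c \<or> f j = Some b \<and> f k = Some c)"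
proof (cases "(\<forall>f\<in>P. f i = Some a) \<or> (\<forall>f\<in>P. f j = Some b)")
  case False
  then obtain f1 f2 where f: "f1 \<in> P" "f1 j \<noteq> Some b" "f2 \<in> P" "f2 i \<noteq> Some a" by auto
  then have f': "f1 i = Some a" "f2 j = Some b" using cov by auto
  then have "\<not> agree (f1 i) (f2 i)" "\<not> agree (f1 j) (f2 j)" using f by (metis agree_def)+
  then have "agree (f1 k) (f2 k)" using P [OF f(1,3)] by blast
  then obtain c where c: "f1 k = Some c" "f2 k = Some c" unfolding agree_def by (metis not_None_eq)
  have "h i = Some a \<and> h j = Some b \<or> h i = Some a \<and> h k = Some c \<or> h j = Some b \<and> h k = Some c"
    if h: "h \<in> P" for h
    using cov [OF h] P [OF h f(1)] P [OF h f(3)] f f' c unfolding agree_def by metis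
  then show ?thesis by blast
qed blast

text \<open>Either two labels of different colours meet every pattern, and
  \<open>intersecting_star_or_majority\<close> applies, or no such pair does. Then a pattern
  \<open>f\<close> and three patterns, each avoiding two labels of \<open>f\<close>, are the four
  lines of the Fano plane with one point removed; any further pattern has to meet all four and is
  one of them.\<close>

lemma intersecting_classification:
  fixes P :: "(nat \<Rightarrow> 'l option) set"
  assumes P: "\<And>f g. f \<in> P \<Longrightarrow> g \<in> P \<Longrightarrow> agree (f 0) (g 0) \<or> agree (f 1) (g 1) \<or> agree (f 2) (g 2)"
  obtains (star) i l where "i < 3" "\<And>f. f \<in> P \<Longrightarrow> f i = Some l"
  | (majority) a :: "nat \<Rightarrow> 'l" where
     "\<And>f. f \<in> P \<Longrightarrow> f 0 = Some (a 0) \<and> f 1 = Some (a 1) \<or> f 0 = Some (a 0) \<and> f 2 = Some (a 2)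
        \<or> f 1 = Some (a 1) \<and> f 2 = Some (a 2)"
  | (fano) a b :: "nat \<Rightarrow> 'l" where "a 0 \<noteq> b 0" "a 1 \<noteq> b 1" "a 2 \<noteq> b 2"
     "\<And>f. f \<in> P \<Longrightarrow> (f 0, f 1, f 2) \<in> {(Some (a 0), Some (a 1), Some (a 2)),
        (Some (b 0), Some (b 1), Some (a 2)), (Some (b 0), Some (a 1), Some (b 2)),
        (Some (a 0), Some (b 1), Some (b 2))}"
proof -
  have Pperm: "agree (f 1) (g 1) \<or> agree (f 2) (g 2) \<or> agree (f 0) (g 0)"
    "agree (f 0) (g 0) \<or> agree (f 2) (g 2) \<or> agree (f 1) (g 1)"
    if "f \<in> P" "g \<in> P" for f g using P [OF that] by auto
  consider (c01) a b where "\<And>f. f \<in> P \<Longrightarrow> f 0 = Some a \<or> f 1 = Some b"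
    | (c12) a b where "\<And>f. f \<in> P \<Longrightarrow> f 1 = Some a \<or> f 2 = Some b"
    | (c02) a b where "\<And>f. f \<in> P \<Longrightarrow> f 0 = Some a \<or> f 2 = Some b"
    | (non) "\<And>a b. \<exists>f\<in>P. f 0 \<noteq> Some a \<and> f 1 \<noteq> Some b" "\<And>a b. \<exists>f\<in>P. f 1 \<noteq> Some a \<and> f 2 \<noteq> Some b"
        "\<And>a b. \<exists>f\<in>P. f 0 \<noteq> Some a \<and> f 2 \<noteq> Some b"
    by meson
  then show thesis
  proof cases
    case (c01 a b)
    consider "\<forall>f\<in>P. f 0 = Some a" | "\<forall>f\<in>P. f 1 = Some b"
      | c where "\<forall>f\<in>P. f 0 = Some a \<and> f 1 = Some b \<or> f 0 = Some a \<and> f 2 = Some c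
          \<or> f 1 = Some b \<and> f 2 = Some c"
      using intersecting_star_or_majority [of P 0 1 2, OF P c01] by blast
    then show thesis
    proof cases
      case 1
      then show thesis by (intro star [of 0 a]) simp_all
    next
      case 2
      then show thesis by (intro star [of 1 b]) simp_all
    next
      case (3 c)
      show thesis
      proof (rule majority [of "\<lambda>i :: nat. if i = 0 then a else if i = 1 then b else c"])
        show "f 0 = Some ((\<lambda>i :: nat. if i = 0 then a else if i = 1 then b else c) 0) \<and> f 1 = Some ((\<lambda>i :: nat. if i = 0 then a else if i = 1 then b else c) 1) \<or>
            f 0 = Some ((\<lambda>i :: nat. if i = 0 then a else if i = 1 then b else c) 0) \<and> f 2 = Some ((\<lambda>i :: nat. if i = 0 then a else if i = 1 then b else c) 2) \<or>
            f 1 = Some ((\<lambda>i :: nat. if i = 0 then a else if i = 1 then b else c) 1) \<and> f 2 = Some ((\<lambda>i :: nat. if i = 0 then a else if i = 1 then b else c) 2)" if "f \<in> P" for f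
          using bspec [OF 3 that] by auto
      qed
    qed
  next
    case (c12 a b)
    consider "\<forall>f\<in>P. f 1 = Some a" | "\<forall>f\<in>P. f 2 = Some b"
      | c where "\<forall>f\<in>P. f 1 = Some a \<and> f 2 = Some b \<or> f 1 = Some a \<and> f 0 = Some c
          \<or> f 2 = Some b \<and> f 0 = Some c"
      using intersecting_star_or_majority [of P 1 2 0, OF Pperm(1) c12] by blast
    then show thesis
    proof cases
      case 1
      then show thesis by (intro star [of 1 a]) simp_all
    next
      case 2
      then show thesis by (intro star [of 2 b]) simp_all
    next
      case (3 c)
      show thesis
      proof (rule majority [of "\<lambda>i :: nat. if i = 0 then c else if i = 1 then a else b"])
        show "f 0 = Some ((\<lambda>i :: nat. if i = 0 then c else if i = 1 then a else b) 0) \<and> f 1 = Some ((\<lambda>i :: nat. if i = 0 then c else if i = 1 then a else b) 1) \<or>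
            f 0 = Some ((\<lambda>i :: nat. if i = 0 then c else if i = 1 then a else b) 0) \<and> f 2 = Some ((\<lambda>i :: nat. if i = 0 then c else if i = 1 then a else b) 2) \<or>
            f 1 = Some ((\<lambda>i :: nat. if i = 0 then c else if i = 1 then a else b) 1) \<and> f 2 = Some ((\<lambda>i :: nat. if i = 0 then c else if i = 1 then a else b) 2)" if "f \<in> P" for f
          using bspec [OF 3 that] by auto
      qed
    qed
  next
    case (c02 a b)
    consider "\<forall>f\<in>P. f 0 = Some a" | "\<forall>f\<in>P. f 2 = Some b"
      | c where "\<forall>f\<in>P. f 0 = Some a \<and> f 2 = Some b \<or> f 0 = Some a \<and> f 1 = Some c
          \<or> f 2 = Some b \<and> f 1 = Some c"
      using intersecting_star_or_majority [of P 0 2 1, OF Pperm(2) c02] by blast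
    then show thesis
    proof cases
      case 1
      then show thesis by (intro star [of 0 a]) simp_all
    next
      case 2
      then show thesis by (intro star [of 2 b]) simp_all
    next
      case (3 c)
      show thesis
      proof (rule majority [of "\<lambda>i :: nat. if i = 0 then a else if i = 1 then c else b"])
        show "f 0 = Some ((\<lambda>i :: nat. if i = 0 then a else if i = 1 then c else b) 0) \<and> f 1 = Some ((\<lambda>i :: nat. if i = 0 then a else if i = 1 then c else b) 1) \<or>
            f 0 = Some ((\<lambda>i :: nat. if i = 0 then a else if i = 1 then c else b) 0) \<and> f 2 = Some ((\<lambda>i :: nat. if i = 0 then a else if i = 1 then c else b) 2) \<or>
            f 1 = Some ((\<lambda>i :: nat. if i = 0 then a else if i = 1 then c else b) 1) \<and> f 2 = Some ((\<lambda>i :: nat. if i = 0 then a else if i = 1 then c else b) 2)" if "f \<in> P" for f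
          using bspec [OF 3 that] by auto
      qed
    qed
  next
    case non
    obtain f where f: "f \<in> P" using non by blast
    \<comment> \<open>A dummy value as long as \<open>f i\<close> might be \<open>None\<close>. That
      is excluded afterwards: \<open>g\<close> avoids \<open>a 0\<close> and \<open>a 1\<close>, so
      it meets \<open>f\<close> in colour 2; likewise \<open>h\<close> in colour 1 and
      \<open>k\<close> in colour 0.\<close>
    define a where "a i = the (f i)" for i
    obtain g where g: "g \<in> P" "g 0 \<noteq> Some (a 0)" "g 1 \<noteq> Some (a 1)" using non(1) by blast
    obtain h where h: "h \<in> P" "h 0 \<noteq> Some (a 0)" "h 2 \<noteq> Some (a 2)" using non(3) by blast
    obtain k where k: "k \<in> P" "k 1 \<noteq> Some (a 1)" "k 2 \<noteq> Some (a 2)" using non(2) by blast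
    have fa': "f 0 \<noteq> None" "f 1 \<noteq> None" "f 2 \<noteq> None" and g2: "g 2 = Some (a 2)"
      and h1: "h 1 = Some (a 1)" and k0: "k 0 = Some (a 0)"
      using P [OF f g(1)] P [OF f h(1)] P [OF f k(1)] g(2,3) h(2,3) k(2,3)
      unfolding a_def agree_def by (metis option.collapse)+
    have fa: "f 0 = Some (a 0)" "f 1 = Some (a 1)" "f 2 = Some (a 2)"
      using fa' by (simp_all add: a_def)
    \<comment> \<open>Any two of \<open>g\<close>, \<open>h\<close>, \<open>k\<close> must meet, and
      each pair has just one colour left for it; this yields a second label per colour.\<close>
    define b where "b i = (if i = 2 then the (h 2) else the (g i))" for i
    have gb: "g 0 = Some (b 0)" "g 1 = Some (b 1)" and hb: "h 0 = Some (b 0)" "h 2 = Some (b 2)"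
       and kb: "k 1 = Some (b 1)" "k 2 = Some (b 2)"
    proof -
      have b: "b 0 = the (g 0)" "b 1 = the (g 1)" "b 2 = the (h 2)" by (simp_all add: b_def)
      have "agree (g 0) (h 0)" "agree (h 2) (k 2)" "agree (g 1) (k 1)"
        using P [OF g(1) h(1)] P [OF h(1) k(1)] P [OF g(1) k(1)] g(2,3) h(2,3) k(2,3) g2 h1 k0
        unfolding agree_def by metis+
      then show "g 0 = Some (b 0)" "g 1 = Some (b 1)" "h 0 = Some (b 0)" "h 2 = Some (b 2)"
          "k 1 = Some (b 1)" "k 2 = Some (b 2)"
        unfolding b agree_def by (metis option.collapse)+
    qed
    have ne: "a 0 \<noteq> b 0" "a 1 \<noteq> b 1" "a 2 \<noteq> b 2" using g(2,3) h(3) gb hb by metis+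
    show thesis
    proof (rule fano [of a b])
      fix e assume e: "e \<in> P"
      show "(e 0, e 1, e 2) \<in> {(Some (a 0), Some (a 1), Some (a 2)),
        (Some (b 0), Some (b 1), Some (a 2)), (Some (b 0), Some (a 1), Some (b 2)),
        (Some (a 0), Some (b 1), Some (b 2))}"
        using P [OF e f] P [OF e g(1)] P [OF e h(1)] P [OF e k(1)] ne
        unfolding agree_def fa gb hb kb g2 h1 k0 insert_iff prod.inject by (metis option.inject)
    qed (use ne in auto)
  qed
qed

section \<open>Stability, expansion and covers by three labels\<close>

lemma less_3_cases: "i < 3 \<longleftrightarrow> i = 0 \<or> i = 1 \<or> i = (2 :: nat)"
  by presburger
lemma less_4_cases: "i < 4 \<longleftrightarrow> i = 0 \<or> i = 1 \<or> i = 2 \<or> i = (3 :: nat)"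
  by presburger
lemma ex_less_3: "(\<exists>i<3. Q i) \<longleftrightarrow> Q 0 \<or> Q 1 \<or> Q (2 :: nat)"
  unfolding less_3_cases by blast
lemma all_less_3: "(\<forall>i<3. Q i) \<longleftrightarrow> Q 0 \<and> Q 1 \<and> Q (2 :: nat)"
  unfolding less_3_cases by blast
lemma all_less_4: "(\<forall>i<4. Q i) \<longleftrightarrow> Q 0 \<and> Q 1 \<and> Q 2 \<and> Q (3 :: nat)"
  unfolding less_4_cases by blast

text \<open>For three vertices \<open>S\<close> and \<open>card M <= 1 / p\<close>, the random graph
  has of the order of \<open>n * p ^ 4 * card M\<close> such vertices when \<open>S\<close> and
  \<open>M\<close> are disjoint: here the fourth power enters. Overlaps of \<open>S\<close> and
  \<open>M\<close> are allowed.\<close>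

definition common_nbs :: "('v \<Rightarrow> 'v \<Rightarrow> bool) \<Rightarrow> 'v set \<Rightarrow> 'v set \<Rightarrow> 'v set \<Rightarrow> 'v set" where
  "common_nbs adj V S M = {v\<in>V. (\<forall>s\<in>S. adj s v) \<and> (\<exists>m\<in>M. adj m v)}"

text \<open>Otherwise the two sets contain subsets of size \<open>L\<close> whose labels are
  disjoint in all three colours; but some edge joins these subsets, and its ends share a
  label.\<close>

lemma large_homogeneous_share_label:
  fixes lab :: "nat \<Rightarrow> 'v \<Rightarrow> 'l"
  assumes "finite V" "X \<subseteq> V" "Y \<subseteq> V"
    and big: "27 * s \<le> card X" "27 * t \<le> card Y" "L \<le> s" "L \<le> t" "0 < L"
    and hom: "\<And>i. i < 3 \<Longrightarrow> hom_type lab s X i (f i)" "\<And>i. i < 3 \<Longrightarrow> hom_type lab t Y i (g i)"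
    and labs: "\<And>x y. x \<in> V \<Longrightarrow> y \<in> V \<Longrightarrow> adj x y \<Longrightarrow> \<exists>i<3. lab i x = lab i y"
    and dense: "\<And>X Y. X \<subseteq> V \<Longrightarrow> Y \<subseteq> V \<Longrightarrow> X \<inter> Y = {} \<Longrightarrow> card X = L \<Longrightarrow> card Y = L
       \<Longrightarrow> \<exists>x\<in>X. \<exists>y\<in>Y. adj x y"
  shows "\<exists>i<3. agree (f i) (g i)"
proof (rule ccontr)
  assume no: "\<not> ?thesis"
  have fin: "finite X" "finite Y" using assms(1-3) finite_subset by auto
  have b: "3 ^ 3 * s \<le> card X" "3 ^ 3 * t \<le> card Y" using big by simp_all
  have "f i \<noteq> g i \<or> f i = None" if "i < 3" for i using no that by (auto simp: agree_def)
  from separate_colours [OF fin b hom this] obtain X' Y' where XY: "X' \<subseteq> X" "Y' \<subseteq> Y" "s \<le> card X'" "t \<le> card Y'"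
    "\<forall>i<3. lab i ` X' \<inter> lab i ` Y' = {}" by blast
  obtain X1 where X1: "X1 \<subseteq> X'" "card X1 = L" using XY big by (meson obtain_subset_with_card_n order_trans)
  obtain Y1 where Y1: "Y1 \<subseteq> Y'" "card Y1 = L" using XY big by (meson obtain_subset_with_card_n order_trans)
  have "lab 0 ` X' \<inter> lab 0 ` Y' = {}" using XY(5) by simp
  then have "X1 \<inter> Y1 = {}" using X1(1) Y1(1) by blast
  then obtain x y where xy: "x \<in> X1" "y \<in> Y1" "adj x y"
    using dense [of X1 Y1] X1 Y1 XY(1,2) assms(2,3) by blast
  then obtain i where "i < 3" "lab i x = lab i y" using labs [of x y] X1 Y1 XY assms(2,3) by blast
  then show False using XY(5) xy X1 Y1 by blast
qed

text \<open>\<open>P\<close>, the family of patterns occurring on large sets, is intersecting by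
  \<open>large_homogeneous_share_label\<close>. The vertices violating the description obtained from
  its classification cannot number \<open>27 ^ 4 * L\<close>, since they would contain a large
  homogeneous set whose pattern belongs to \<open>P\<close>.\<close>

lemma stability:
  fixes lab :: "nat \<Rightarrow> 'v \<Rightarrow> 'l"
  assumes fin: "finite V" and L: "0 < L"
    and labs: "\<And>x y. x \<in> V \<Longrightarrow> y \<in> V \<Longrightarrow> adj x y \<Longrightarrow> \<exists>i<3. lab i x = lab i y"
    and dense: "\<And>X Y. X \<subseteq> V \<Longrightarrow> Y \<subseteq> V \<Longrightarrow> X \<inter> Y = {} \<Longrightarrow> card X = L \<Longrightarrow> card Y = L
       \<Longrightarrow> \<exists>x\<in>X. \<exists>y\<in>Y. adj x y"
  obtains (star) i l where "i < 3" "card {v\<in>V. lab i v \<noteq> l} < 27 ^ 4 * L"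
  | (majority) a :: "nat \<Rightarrow> 'l" where
     "card {v\<in>V. \<not> (lab 0 v = a 0 \<and> lab 1 v = a 1 \<or> lab 0 v = a 0 \<and> lab 2 v = a 2
        \<or> lab 1 v = a 1 \<and> lab 2 v = a 2)} < 27 ^ 4 * L"
  | (fano) a b :: "nat \<Rightarrow> 'l" where "a 0 \<noteq> b 0" "a 1 \<noteq> b 1" "a 2 \<noteq> b 2"
     "card {v\<in>V. (lab 0 v, lab 1 v, lab 2 v) \<notin> {(a 0, a 1, a 2),
        (b 0, b 1, a 2), (b 0, a 1, b 2), (a 0, b 1, b 2)}} < 27 ^ 4 * L"
proof -
  define P where "P = {f. \<exists>Y\<subseteq>V. \<exists>s\<ge>L. 27 * s \<le> card Y \<and> (\<forall>i<3. hom_type lab s Y i (f i))}"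
  have P: "agree (f 0) (g 0) \<or> agree (f 1) (g 1) \<or> agree (f 2) (g 2)" if fg: "f \<in> P" "g \<in> P" for f g
  proof -
    obtain X s where X: "X \<subseteq> V" "L \<le> s" "27 * s \<le> card X" "\<forall>i<3. hom_type lab s X i (f i)"
      using fg(1) unfolding P_def by blast
    obtain Y t where Y: "Y \<subseteq> V" "L \<le> t" "27 * t \<le> card Y" "\<forall>i<3. hom_type lab t Y i (g i)"
      using fg(2) unfolding P_def by blast
    have "\<exists>i<3. agree (f i) (g i)"
      by (rule large_homogeneous_share_label [OF fin X(1) Y(1) X(3) Y(3) X(2) Y(2) L _ _ labs dense])
        (use X(4) Y(4) in auto)
    then show ?thesis unfolding ex_less_3 .
  qed
  have few: "card {v\<in>V. \<not> Q v} < 27 ^ 4 * L"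
    if "\<And>f Y s. f \<in> P \<Longrightarrow> \<forall>i<3. hom_type lab s Y i (f i) \<Longrightarrow> Y \<noteq> {} \<Longrightarrow> \<exists>y\<in>Y. Q y" for Q
  proof (rule ccontr)
    assume "\<not> ?thesis"
    then have "27 ^ (3 + 1) * L \<le> card {v\<in>V. \<not> Q v}" by simp
    then have "\<exists>Y\<subseteq>{v\<in>V. \<not> Q v}. \<exists>s\<ge>L. \<exists>f. 27 * s \<le> card Y \<and> (\<forall>i<3. hom_type lab s Y i (f i))"
      by (rule homogeneous_subset [where J = "{}", rotated]) (use fin in auto)
    then obtain Y s f where Y: "Y \<subseteq> {v\<in>V. \<not> Q v}" "L \<le> s" "27 * s \<le> card Y"
      "\<forall>i<3. hom_type lab s Y i (f i)" by blast
    have "Y \<noteq> {}" using Y(2,3) L by auto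
    moreover have "f \<in> P" unfolding P_def using Y by (intro CollectI exI [of _ Y] conjI exI [of _ s]) auto
    ultimately show False using that [OF _ Y(4)] Y(1) by blast
  qed
  have val: "lab i y = l" if "\<forall>i<3. hom_type lab s Y i (f i)" "i < 3" "f i = Some l" "y \<in> Y" for f Y s i l y
  proof -
    have "hom_type lab s Y i (Some l)" using that(1-3) by metis
    then show ?thesis using that(4) by (simp add: hom_type_def)
  qed
  show thesis
  proof (rule intersecting_classification [of P])
    fix i l assume star: "i < 3" "\<And>f. f \<in> P \<Longrightarrow> f i = Some l"
    have "card {v\<in>V. \<not> lab i v = l} < 27 ^ 4 * L"
    proof (rule few)
      fix f Y s assume *: "f \<in> P" "\<forall>i<3. hom_type lab s Y i (f i)" "Y \<noteq> {}"
      then show "\<exists>y\<in>Y. lab i y = l" using val [OF *(2) star(1) star(2) [OF *(1)]] by blast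
    qed
    then show thesis using that(1) star(1) by blast
  next
    fix a :: "nat \<Rightarrow> 'l"
    assume majority: "\<And>f. f \<in> P \<Longrightarrow> f 0 = Some (a 0) \<and> f 1 = Some (a 1) \<or> f 0 = Some (a 0) \<and> f 2 = Some (a 2)
        \<or> f 1 = Some (a 1) \<and> f 2 = Some (a 2)"
    show thesis
    proof (rule that(2), rule few)
      fix f Y s assume *: "f \<in> P" "\<forall>i<3. hom_type lab s Y i (f i)" "Y \<noteq> {}"
      obtain y where y: "y \<in> Y" using *(3) by auto
      have "f 0 = Some k \<Longrightarrow> lab 0 y = k" "f 1 = Some k \<Longrightarrow> lab 1 y = k" "f 2 = Some k \<Longrightarrow> lab 2 y = k" for k
        by (rule val [OF *(2) _ _ y]; simp)+
      then have "lab 0 y = a 0 \<and> lab 1 y = a 1 \<or> lab 0 y = a 0 \<and> lab 2 y = a 2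
        \<or> lab 1 y = a 1 \<and> lab 2 y = a 2"
        using majority [OF *(1)] by blast
      then show "\<exists>v\<in>Y. lab 0 v = a 0 \<and> lab 1 v = a 1 \<or> lab 0 v = a 0 \<and> lab 2 v = a 2
        \<or> lab 1 v = a 1 \<and> lab 2 v = a 2" using y by blast
    qed
  next
    fix a b :: "nat \<Rightarrow> 'l"
    assume fano: "a 0 \<noteq> b 0" "a 1 \<noteq> b 1" "a 2 \<noteq> b 2"
     "\<And>f. f \<in> P \<Longrightarrow> (f 0, f 1, f 2) \<in> {(Some (a 0), Some (a 1), Some (a 2)),
        (Some (b 0), Some (b 1), Some (a 2)), (Some (b 0), Some (a 1), Some (b 2)),
        (Some (a 0), Some (b 1), Some (b 2))}"
    show thesis
    proof (rule that(3) [OF fano(1-3)], rule few)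
      fix f Y s assume *: "f \<in> P" "\<forall>i<3. hom_type lab s Y i (f i)" "Y \<noteq> {}"
      obtain y where y: "y \<in> Y" using *(3) by auto
      have val': "f 0 = Some k \<Longrightarrow> lab 0 y = k" "f 1 = Some k \<Longrightarrow> lab 1 y = k" "f 2 = Some k \<Longrightarrow> lab 2 y = k" for k
        by (rule val [OF *(2) _ _ y]; simp)+
      have "(lab 0 y, lab 1 y, lab 2 y) \<in> {(a 0, a 1, a 2),
        (b 0, b 1, a 2), (b 0, a 1, b 2), (a 0, b 1, b 2)}"
        using fano(4) [OF *(1)] unfolding insert_iff empty_iff prod.inject by (blast dest: val')
      then show "\<exists>v\<in>Y. (lab 0 v, lab 1 v, lab 2 v) \<in> {(a 0, a 1, a 2),
        (b 0, b 1, a 2), (b 0, a 1, b 2), (a 0, b 1, b 2)}" using y by blast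
    qed
  qed (rule P)
qed

text \<open>\<open>M\<close> is the largest of the four sets. One vertex from each of the others,
  together with \<open>M\<close>, has too many common neighbours for the union, which has at most
  \<open>4 * card M\<close> elements and fewer than \<open>K\<close>. The second bound serves when
  \<open>M\<close> is larger than \<open>q\<close> and has to be cut down to that size.\<close>

lemma expansion_four:
  assumes fin: "finite V"
    and ne: "M \<noteq> {}" "M0 \<noteq> {}" "M1 \<noteq> {}" "M2 \<noteq> {}"
    and sub: "M \<subseteq> V" "M0 \<subseteq> V" "M1 \<subseteq> V" "M2 \<subseteq> V"
    and max: "card M0 \<le> card M" "card M1 \<le> card M" "card M2 \<le> card M"
    and K: "card (M0 \<union> M1 \<union> M2 \<union> M) < K"
    and q: "0 < q"
    and exp: "\<And>S M. S \<subseteq> V \<Longrightarrow> card S \<le> 3 \<Longrightarrow> M \<subseteq> V \<Longrightarrow> M \<noteq> {} \<Longrightarrow> card M \<le> q \<Longrightarrow>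
       4 * card M < card (common_nbs adj V S M)"
    and exp': "\<And>S M. S \<subseteq> V \<Longrightarrow> card S \<le> 3 \<Longrightarrow> M \<subseteq> V \<Longrightarrow> card M = q \<Longrightarrow>
       K \<le> card (common_nbs adj V S M)"
  shows "\<exists>v\<in>V. v \<notin> M0 \<union> M1 \<union> M2 \<union> M \<and> (\<forall>A\<in>{M0, M1, M2, M}. \<exists>e\<in>A. adj e v)"
proof -
  obtain e0 e1 e2 where e: "e0 \<in> M0" "e1 \<in> M1" "e2 \<in> M2" using ne by blast
  let ?S = "{e0, e1, e2}"
  have S: "?S \<subseteq> V" "card ?S \<le> 3" using e sub by (auto simp: card_insert_if)
  have finM: "finite M0" "finite M1" "finite M2" "finite M" using sub fin by (simp_all add: finite_subset)
  have "\<exists>M'\<subseteq>M. card (M0 \<union> M1 \<union> M2 \<union> M) < card (common_nbs adj V ?S M')"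
  proof (cases "card M \<le> q")
    case True
    have "card (M0 \<union> M1 \<union> M2 \<union> M) \<le> card M0 + card M1 + card M2 + card M"
      by (meson card_Un_le add_mono order_trans order_refl)
    then show ?thesis using exp [OF S sub(1) ne(1) True] max by (intro exI [of _ M]) auto
  next
    case False
    then obtain M' where M': "M' \<subseteq> M" "card M' = q" using obtain_subset_with_card_n [of q M] by auto
    then show ?thesis using exp' [OF S _ M'(2)] sub(1) K
      by (intro exI [of _ M']) (auto intro: less_le_trans)
  qed
  then obtain M' where M': "M' \<subseteq> M" "card (M0 \<union> M1 \<union> M2 \<union> M) < card (common_nbs adj V ?S M')" by blast
  have "\<not> common_nbs adj V ?S M' \<subseteq> M0 \<union> M1 \<union> M2 \<union> M"
    using M'(2) finM by (meson card_mono finite_Un not_le)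
  then obtain v where "v \<in> common_nbs adj V ?S M'" "v \<notin> M0 \<union> M1 \<union> M2 \<union> M" by blast
  then show ?thesis using e M'(1) unfolding common_nbs_def by blast
qed

lemma expansion_four_sym:
  fixes M :: "nat \<Rightarrow> 'v set"
  assumes fin: "finite V"
    and ne: "\<And>j. j < 4 \<Longrightarrow> M j \<noteq> {}" and sub: "\<And>j. j < 4 \<Longrightarrow> M j \<subseteq> V"
    and K: "card (\<Union>j<4. M j) < K" and q: "0 < q"
    and exp: "\<And>S M. S \<subseteq> V \<Longrightarrow> card S \<le> 3 \<Longrightarrow> M \<subseteq> V \<Longrightarrow> M \<noteq> {} \<Longrightarrow> card M \<le> q \<Longrightarrow>
       4 * card M < card (common_nbs adj V S M)"
    and exp': "\<And>S M. S \<subseteq> V \<Longrightarrow> card S \<le> 3 \<Longrightarrow> M \<subseteq> V \<Longrightarrow> card M = q \<Longrightarrow>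
       K \<le> card (common_nbs adj V S M)"
  shows "\<exists>v\<in>V. \<forall>j<4. v \<notin> M j \<and> (\<exists>e\<in>M j. adj e v)"
proof -
  have "\<exists>i<4. \<forall>j<4. card (M j) \<le> card (M i)"
  proof -
    have "Max ((\<lambda>j. card (M j)) ` {..<4}) \<in> (\<lambda>j. card (M j)) ` {..<4}"
      by (intro Max_in) (auto simp: lessThan_empty_iff)
    then obtain i where "i < 4" "card (M i) = Max ((\<lambda>j. card (M j)) ` {..<4})" by auto
    then show ?thesis by (intro exI [of _ i]) auto
  qed
  then obtain i where i: "i < 4" "\<And>j. j < 4 \<Longrightarrow> card (M j) \<le> card (M i)" by blast
  \<comment> \<open>The three indices other than that of a largest set.\<close>
  define a b c where "a = (i + 1) mod 4" and "b = (i + 2) mod 4" and "c = (i + 3) mod 4"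
  have abc: "a < 4" "b < 4" "c < 4" by (simp_all add: a_def b_def c_def)
  have all: "j \<in> {a, b, c, i}" if "j < 4" for j
    using that i(1) unfolding less_4_cases a_def b_def c_def by (elim disjE) simp_all
  have set: "(\<Union>j<4. M j) = M a \<union> M b \<union> M c \<union> M i" using all abc i(1) by blast
  have "\<exists>v\<in>V. v \<notin> M a \<union> M b \<union> M c \<union> M i \<and> (\<forall>A\<in>{M a, M b, M c, M i}. \<exists>e\<in>A. adj e v)"
    by (rule expansion_four [where K = K and q = q, OF fin _ _ _ _ _ _ _ _ _ _ _ _ q exp exp'])
      (use ne sub i abc K set in auto)
  then obtain v where v: "v \<in> V" "v \<notin> M a \<union> M b \<union> M c \<union> M i" "\<forall>A\<in>{M a, M b, M c, M i}. \<exists>e\<in>A. adj e v"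
    by blast
  have "v \<notin> M j \<and> (\<exists>e\<in>M j. adj e v)" if "j < 4" for j using all [OF that] v(2,3) by auto
  then show ?thesis using v(1) by blast
qed

text \<open>Read \<open>w\<close> as an edge between \<open>f w\<close> and \<open>g w\<close> in a
  bipartite graph: the hypothesis excludes a matching of three edges, and the conclusion is a vertex
  cover of size two. The proof takes two disjoint edges \<open>x\<close> and \<open>y\<close>, and
  for each of the four covers consisting of one end of \<open>x\<close> and one end of
  \<open>y\<close> an edge that it misses.\<close>

lemma konig_two:
  assumes three: "\<And>x y z. x \<in> W \<Longrightarrow> y \<in> W \<Longrightarrow> z \<in> W \<Longrightarrow>
      \<exists>c d. (f x = c \<or> g x = d) \<and> (f y = c \<or> g y = d) \<and> (f z = c \<or> g z = d)"
  shows "(\<exists>c d. \<forall>w\<in>W. f w = c \<or> f w = d) \<or> (\<exists>c d. \<forall>w\<in>W. g w = c \<or> g w = d)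
    \<or> (\<exists>c d. \<forall>w\<in>W. f w = c \<or> g w = d)"
proof (rule ccontr)
  assume no: "\<not> ?thesis"
  have nomatch: False if "x \<in> W" "y \<in> W" "z \<in> W" "f x \<noteq> f y" "f x \<noteq> f z" "f y \<noteq> f z"
     "g x \<noteq> g y" "g x \<noteq> g z" "g y \<noteq> g z" for x y z
    using three [OF that(1-3)] that(4-) by metis
  obtain x where x: "x \<in> W" using no by blast
  obtain y where y: "y \<in> W" "f y \<noteq> f x" "g y \<noteq> g x" using no by blast
  obtain z where z: "z \<in> W" "f z \<noteq> f x" "f z \<noteq> f y" using no by blast
  obtain w where w: "w \<in> W" "g w \<noteq> g x" "g w \<noteq> g y" using no by blast
  obtain u where u: "u \<in> W" "f u \<noteq> f x" "g u \<noteq> g y" using no by blast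
  obtain v where v: "v \<in> W" "f v \<noteq> f y" "g v \<noteq> g x" using no by blast
  have gz: "g z = g x \<or> g z = g y" using nomatch [of x y z] x y z by metis
  have fw: "f w = f x \<or> f w = f y" using nomatch [of x y w] x y w by metis
  show False
  proof (cases "g z = g x")
    case True
    have "f w = f y" using nomatch [of y z w] fw True x y z w by metis
    then show False
      using nomatch [of v z w] nomatch [of v x w] nomatch [of v x y] nomatch [of v z y] True x y z w v by metis
  next
    case False
    then have gz': "g z = g y" using gz by blast
    have "f w = f x" using nomatch [of x z w] fw gz' x y z w by metis
    then show False
      using nomatch [of u z w] nomatch [of u y w] nomatch [of u y x] nomatch [of u z x] gz' x y z w u by metis
  qed
qed

text \<open>A Helly property. If every colour varies on \<open>W\<close>, take \<open>x\<close> and,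
  for each colour, a vertex differing from \<open>x\<close> there. Any two of these three agree with
  \<open>x\<close> in the remaining colour, so in no colour do all three agree.\<close>

lemma one_label_if_triples_share:
  fixes lab :: "nat \<Rightarrow> 'v \<Rightarrow> 'l"
  assumes "\<And>x y z. x \<in> W \<Longrightarrow> y \<in> W \<Longrightarrow> z \<in> W \<Longrightarrow> \<exists>i<3. lab i x = lab i y \<and> lab i x = lab i z"
  shows "\<exists>i<3. \<exists>l. \<forall>v\<in>W. lab i v = l"
proof (rule ccontr)
  assume "\<not> ?thesis"
  then have no: "\<exists>v\<in>W. lab i v \<noteq> l" if "i < 3" for i l using that by blast
  have three: "lab 0 x = lab 0 y \<and> lab 0 x = lab 0 z \<or> lab 1 x = lab 1 y \<and> lab 1 x = lab 1 z
      \<or> lab 2 x = lab 2 y \<and> lab 2 x = lab 2 z" if xyz: "x \<in> W" "y \<in> W" "z \<in> W" for x y z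
    using assms [OF xyz] unfolding ex_less_3 .
  obtain x where x: "x \<in> W" using no [of 0] by auto
  obtain y0 where y0: "y0 \<in> W" "lab 0 y0 \<noteq> lab 0 x" using no [of 0] by auto
  obtain y1 where y1: "y1 \<in> W" "lab 1 y1 \<noteq> lab 1 x" using no [of 1] by auto
  obtain y2 where y2: "y2 \<in> W" "lab 2 y2 \<noteq> lab 2 x" using no [of 2] by auto
  show False
    using three [of x y0 y1] three [of x y0 y2] three [of x y1 y2] three [of y0 y1 y2] x y0 y1 y2 by metis
qed

text \<open>The dense case with the probability removed. \<open>dense\<close> supplies the structure
  with fewer than \<open>27 ^ 4 * L\<close> exceptional vertices; \<open>exp'\<close> beats that
  bound, and \<open>exp\<close> deals with sets too small for it.\<close>

theorem three_labels_cover: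
  fixes lab :: "nat \<Rightarrow> 'v \<Rightarrow> 'l"
  assumes fin: "finite V" and L: "0 < L" and q: "0 < q" "q \<le> card V"
    and labs: "\<And>x y. x \<in> V \<Longrightarrow> y \<in> V \<Longrightarrow> adj x y \<Longrightarrow> \<exists>i<3. lab i x = lab i y"
    and dense: "\<And>X Y. X \<subseteq> V \<Longrightarrow> Y \<subseteq> V \<Longrightarrow> X \<inter> Y = {} \<Longrightarrow> card X = L \<Longrightarrow> card Y = L
       \<Longrightarrow> \<exists>x\<in>X. \<exists>y\<in>Y. adj x y"
    and exp: "\<And>S M. S \<subseteq> V \<Longrightarrow> card S \<le> 3 \<Longrightarrow> M \<subseteq> V \<Longrightarrow> M \<noteq> {} \<Longrightarrow> card M \<le> q \<Longrightarrow>
       4 * card M < card (common_nbs adj V S M)"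
    and exp': "\<And>S M. S \<subseteq> V \<Longrightarrow> card S \<le> 3 \<Longrightarrow> M \<subseteq> V \<Longrightarrow> card M = q \<Longrightarrow>
       27 ^ 4 * L \<le> card (common_nbs adj V S M)"
  shows "\<exists>i<3. \<exists>j<3. \<exists>k<3. \<exists>a b c. \<forall>v\<in>V. lab i v = a \<or> lab j v = b \<or> lab k v = c"
proof (rule ccontr)
  assume "\<not> ?thesis"
  then have no: "\<exists>v\<in>V. lab i v \<noteq> a \<and> lab j v \<noteq> b \<and> lab k v \<noteq> c"
    if "i < 3" "j < 3" "k < 3" for i j k a b c using that by blast
  \<comment> \<open>Only the condition on the three vertices is used in \<open>common\<close>;
    \<open>M0\<close> is any set of the size that \<open>exp'\<close> asks for.\<close>
  obtain M0 where M0: "M0 \<subseteq> V" "card M0 = q" using q(2) by (meson obtain_subset_with_card_n)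
  have common: "\<exists>v\<in>V. Q v \<and> adj x v \<and> adj y v \<and> adj z v"
    if few: "card {v\<in>V. \<not> Q v} < 27 ^ 4 * L" and xyz: "x \<in> V" "y \<in> V" "z \<in> V" for Q x y z
  proof -
    have "27 ^ 4 * L \<le> card (common_nbs adj V {x, y, z} M0)"
      using M0 xyz by (intro exp') (auto simp: card_insert_if)
    then have "\<not> common_nbs adj V {x, y, z} M0 \<subseteq> {v\<in>V. \<not> Q v}"
      using few fin card_mono [of "{v\<in>V. \<not> Q v}" "common_nbs adj V {x, y, z} M0"] by auto
    then show ?thesis by (auto simp: common_nbs_def)
  qed
  have labs': "lab 0 x = lab 0 y \<or> lab 1 x = lab 1 y \<or> lab 2 x = lab 2 y"
    if xy: "x \<in> V" "y \<in> V" "adj x y" for x y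
    using labs [OF xy] unfolding ex_less_3 .
  show False
    using fin L labs dense
  proof (rule stability [of V L adj lab])
    fix i l assume i: "i < 3" and few: "card {v\<in>V. lab i v \<noteq> l} < 27 ^ 4 * L"
    define j k where "j = (i + 1) mod 3" and "k = (i + 2) mod 3"
    have jk: "j < 3" "k < 3" by (simp_all add: j_def k_def)
    have ijk: "m = i \<or> m = j \<or> m = k" if "m < 3" for m
      using that i unfolding j_def k_def by presburger
    have "(\<exists>c d. \<forall>w\<in>{v\<in>V. lab i v \<noteq> l}. lab j w = c \<or> lab j w = d) \<or>
      (\<exists>c d. \<forall>w\<in>{v\<in>V. lab i v \<noteq> l}. lab k w = c \<or> lab k w = d) \<or>
      (\<exists>c d. \<forall>w\<in>{v\<in>V. lab i v \<noteq> l}. lab j w = c \<or> lab k w = d)"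
    proof (rule konig_two)
      fix x y z assume "x \<in> {v\<in>V. lab i v \<noteq> l}" "y \<in> {v\<in>V. lab i v \<noteq> l}" "z \<in> {v\<in>V. lab i v \<noteq> l}"
      then have xyz: "x \<in> V" "y \<in> V" "z \<in> V" and ne: "lab i x \<noteq> l" "lab i y \<noteq> l" "lab i z \<noteq> l" by auto
      obtain v where v: "v \<in> V" "lab i v = l" "adj x v" "adj y v" "adj z v"
        using common [OF few xyz] by blast
      \<comment> \<open>\<open>v\<close> carries \<open>l\<close> in colour \<open>i\<close> and
        \<open>u\<close> does not, so their edge needs one of the other colours: the labels of
        \<open>v\<close> in colours \<open>j\<close> and \<open>k\<close> are the required
        \<open>c\<close> and \<open>d\<close>.\<close>
      have "lab j u = lab j v \<or> lab k u = lab k v" if u: "u \<in> V" "lab i u \<noteq> l" "adj u v" for u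
        using labs [OF u(1) v(1) u(3)] ijk v(2) u(2) by metis
      then show "\<exists>c d. (lab j x = c \<or> lab k x = d) \<and> (lab j y = c \<or> lab k y = d) \<and> (lab j z = c \<or> lab k z = d)"
        using xyz ne v by blast
    qed
    then show False
    proof (elim disjE exE)
      fix c d assume "\<forall>w\<in>{v\<in>V. lab i v \<noteq> l}. lab j w = c \<or> lab j w = d"
      then show False using no [OF i jk(1) jk(1), of l c d] by auto
    next
      fix c d assume "\<forall>w\<in>{v\<in>V. lab i v \<noteq> l}. lab k w = c \<or> lab k w = d"
      then show False using no [OF i jk(2) jk(2), of l c d] by auto
    next
      fix c d assume "\<forall>w\<in>{v\<in>V. lab i v \<noteq> l}. lab j w = c \<or> lab k w = d"
      then show False using no [OF i jk, of l c d] by auto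
    qed
  next
    fix a :: "nat \<Rightarrow> 'l"
    define Two where "Two v \<longleftrightarrow> lab 0 v = a 0 \<and> lab 1 v = a 1 \<or> lab 0 v = a 0 \<and> lab 2 v = a 2
        \<or> lab 1 v = a 1 \<and> lab 2 v = a 2" for v
    assume "card {v\<in>V. \<not> (lab 0 v = a 0 \<and> lab 1 v = a 1 \<or> lab 0 v = a 0 \<and> lab 2 v = a 2
        \<or> lab 1 v = a 1 \<and> lab 2 v = a 2)} < 27 ^ 4 * L"
    then have few: "card {v\<in>V. \<not> Two v} < 27 ^ 4 * L" by (simp add: Two_def)
    define N where "N = {v\<in>V. lab 0 v \<noteq> a 0 \<and> lab 1 v \<noteq> a 1 \<and> lab 2 v \<noteq> a 2}"
    \<comment> \<open>A vertex with two majority labels can share with a neighbour in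
      \<open>N\<close> only the label of its remaining colour, so three vertices of \<open>N\<close>
      with such a common neighbour agree there.\<close>
    have "\<exists>i<3. \<exists>l. \<forall>v\<in>N. lab i v = l"
    proof (rule one_label_if_triples_share)
      fix x y z assume xyz: "x \<in> N" "y \<in> N" "z \<in> N"
      then have V: "x \<in> V" "y \<in> V" "z \<in> V" by (auto simp: N_def)
      obtain v where v: "v \<in> V" "Two v" "adj x v" "adj y v" "adj z v" using common [OF few V] by blast
      have "lab 0 x = lab 0 y \<and> lab 0 x = lab 0 z \<or> lab 1 x = lab 1 y \<and> lab 1 x = lab 1 z
         \<or> lab 2 x = lab 2 y \<and> lab 2 x = lab 2 z"
        using labs' [OF V(1) v(1,3)] labs' [OF V(2) v(1,4)] labs' [OF V(3) v(1,5)] xyz v(2)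
        unfolding N_def Two_def mem_Collect_eq by (smt (verit))
      then show "\<exists>i<3. lab i x = lab i y \<and> lab i x = lab i z"
        unfolding ex_less_3 .
    qed
    then obtain c l where c: "c < 3" "\<And>v. v \<in> N \<Longrightarrow> lab c v = l" by blast
    \<comment> \<open>Split by which single majority label a vertex has, with \<open>N\<close> for
      those having none: together these are the vertices with fewer than two.\<close>
    define M where "M j = (if j < 3 then {v\<in>V. lab j v = a j \<and> (\<forall>i<3. i \<noteq> j \<longrightarrow> lab i v \<noteq> a i)} else N)" for j
    have M: "M 0 = {v\<in>V. lab 0 v = a 0 \<and> lab 1 v \<noteq> a 1 \<and> lab 2 v \<noteq> a 2}"
      "M 1 = {v\<in>V. lab 0 v \<noteq> a 0 \<and> lab 1 v = a 1 \<and> lab 2 v \<noteq> a 2}"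
      "M 2 = {v\<in>V. lab 0 v \<noteq> a 0 \<and> lab 1 v \<noteq> a 1 \<and> lab 2 v = a 2}" "M 3 = N"
      unfolding M_def all_less_3 by auto
    have U: "(\<Union>j<4. M j) = {v\<in>V. \<not> Two v}"
    proof -
      have "v \<in> (\<Union>j<4. M j) \<longleftrightarrow> v \<in> M 0 \<or> v \<in> M 1 \<or> v \<in> M 2 \<or> v \<in> M 3" for v
        using all_less_4 [of "\<lambda>j. v \<notin> M j"] by auto
      then show ?thesis unfolding M N_def Two_def by blast
    qed
    have ne: "\<forall>j<4. M j \<noteq> {}"
    proof -
      have "M 3 \<noteq> {}" using no [of 0 1 2 "a 0" "a 1" "a 2"] unfolding M N_def by auto
      \<comment> \<open>Replacing the majority label of one colour by the common label
        \<open>l\<close> of \<open>N\<close> gives three labels that do not cover. A vertex left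
        over lies outside \<open>N\<close> and lacks the other two majority labels, so it has the
        replaced one.\<close>
      moreover have "M 0 \<noteq> {}" using no [OF c(1), of 1 2 l "a 1" "a 2"] c(2) unfolding M N_def by fastforce
      moreover have "M 1 \<noteq> {}" using no [OF c(1), of 0 2 l "a 0" "a 2"] c(2) unfolding M N_def by fastforce
      moreover have "M 2 \<noteq> {}" using no [OF c(1), of 0 1 l "a 0" "a 1"] c(2) unfolding M N_def by fastforce
      ultimately show ?thesis unfolding all_less_4 by blast
    qed
    have sub: "M j \<subseteq> V" for j unfolding M_def N_def by auto
    have "\<exists>v\<in>V. \<forall>j<4. v \<notin> M j \<and> (\<exists>e\<in>M j. adj e v)"
      by (rule expansion_four_sym [where K = "27 ^ 4 * L" and q = q, OF fin _ sub _ q(1) exp exp'])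
        (use ne few U in auto)
    then obtain v where v: "v \<in> V" "\<forall>j<4. v \<notin> M j" "\<forall>j<4. \<exists>e\<in>M j. adj e v" by blast
    have "v \<notin> (\<Union>j<4. M j)" using v(2) by blast
    then have Two: "Two v" using v(1) unfolding U by blast
    obtain e0 e1 e2 e3 where e: "e0 \<in> M 0" "adj e0 v" "e1 \<in> M 1" "adj e1 v" "e2 \<in> M 2" "adj e2 v"
      "e3 \<in> M 3" "adj e3 v" using v(3) unfolding all_less_4 by blast
    have "e0 \<in> V" "e1 \<in> V" "e2 \<in> V" "e3 \<in> V" using e sub by blast+
    \<comment> \<open>If \<open>v\<close> has the majority labels of the two colours other than
      \<open>j\<close>, its neighbour in \<open>M j\<close> forces the one of colour
      \<open>j\<close> as well; then the neighbour in \<open>N\<close> shares no label with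
      \<open>v\<close>.\<close>
    then show False
      using labs' [of e0 v] labs' [of e1 v] labs' [of e2 v] labs' [of e3 v] e v(1) Two
      unfolding M N_def Two_def mem_Collect_eq by metis
  next
    fix a b :: "nat \<Rightarrow> 'l"
    assume ne: "a 0 \<noteq> b 0" "a 1 \<noteq> b 1" "a 2 \<noteq> b 2"
    define F where "F j = (if j = 0 then (a 0, a 1, a 2) else if j = 1 then (b 0, b 1, a 2)
       else if j = 2 then (b 0, a 1, b 2) else (a 0, b 1, b 2))" for j :: nat
    define Fano where "Fano v \<longleftrightarrow> (lab 0 v, lab 1 v, lab 2 v) \<in> {(a 0, a 1, a 2),
        (b 0, b 1, a 2), (b 0, a 1, b 2), (a 0, b 1, b 2)}" for v
    assume "card {v\<in>V. (lab 0 v, lab 1 v, lab 2 v) \<notin> {(a 0, a 1, a 2),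
        (b 0, b 1, a 2), (b 0, a 1, b 2), (a 0, b 1, b 2)}} < 27 ^ 4 * L"
    then have few: "card {v\<in>V. \<not> Fano v} < 27 ^ 4 * L" by (simp add: Fano_def)
    \<comment> \<open>The triples disjoint from the line \<open>F j\<close>. A triple meeting all
      four lines is one of them, so these sets make up the exceptional vertices. Each is nonempty
      because the labels of a line do not cover, and a neighbour in \<open>M j\<close> prevents a
      vertex from having the triple \<open>F j\<close>.\<close>
    define M where "M j = (case F j of (x, y, z) \<Rightarrow> {v\<in>V. lab 0 v \<noteq> x \<and> lab 1 v \<noteq> y \<and> lab 2 v \<noteq> z})" for j
    have M: "M 0 = {v\<in>V. lab 0 v \<noteq> a 0 \<and> lab 1 v \<noteq> a 1 \<and> lab 2 v \<noteq> a 2}"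
      "M 1 = {v\<in>V. lab 0 v \<noteq> b 0 \<and> lab 1 v \<noteq> b 1 \<and> lab 2 v \<noteq> a 2}"
      "M 2 = {v\<in>V. lab 0 v \<noteq> b 0 \<and> lab 1 v \<noteq> a 1 \<and> lab 2 v \<noteq> b 2}"
      "M 3 = {v\<in>V. lab 0 v \<noteq> a 0 \<and> lab 1 v \<noteq> b 1 \<and> lab 2 v \<noteq> b 2}"
      by (simp_all add: M_def F_def)
    have U: "(\<Union>j<4. M j) = {v\<in>V. \<not> Fano v}"
    proof -
      have *: "v \<in> (\<Union>j<4. M j) \<longleftrightarrow> v \<in> M 0 \<or> v \<in> M 1 \<or> v \<in> M 2 \<or> v \<in> M 3" for v
        using all_less_4 [of "\<lambda>j. v \<notin> M j"] by auto
      have "v \<in> M 0 \<or> v \<in> M 1 \<or> v \<in> M 2 \<or> v \<in> M 3 \<longleftrightarrow> v \<in> V \<and> \<not> Fano v" for v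
        using ne unfolding M Fano_def mem_Collect_eq insert_iff empty_iff prod.inject by (smt (verit))
      then show ?thesis using * by blast
    qed
    have ne: "\<forall>j<4. M j \<noteq> {}" unfolding all_less_4 M
      using no [of 0 1 2 "a 0" "a 1" "a 2"] no [of 0 1 2 "b 0" "b 1" "a 2"]
        no [of 0 1 2 "b 0" "a 1" "b 2"] no [of 0 1 2 "a 0" "b 1" "b 2"] by auto
    have sub: "M j \<subseteq> V" for j unfolding M_def by (auto split: prod.splits)
    have "\<exists>v\<in>V. \<forall>j<4. v \<notin> M j \<and> (\<exists>e\<in>M j. adj e v)"
      by (rule expansion_four_sym [where K = "27 ^ 4 * L" and q = q, OF fin _ sub _ q(1) exp exp'])
        (use ne few U in auto)
    then obtain v where v: "v \<in> V" "\<forall>j<4. v \<notin> M j" "\<forall>j<4. \<exists>e\<in>M j. adj e v" by blast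
    have "v \<notin> (\<Union>j<4. M j)" using v(2) by blast
    then have Fano: "Fano v" using v(1) unfolding U by blast
    obtain e0 e1 e2 e3 where e: "e0 \<in> M 0" "adj e0 v" "e1 \<in> M 1" "adj e1 v" "e2 \<in> M 2" "adj e2 v"
      "e3 \<in> M 3" "adj e3 v" using v(3) unfolding all_less_4 by blast
    have "e0 \<in> V" "e1 \<in> V" "e2 \<in> V" "e3 \<in> V" using e sub by blast+
    then show False
      using labs' [of e0 v] labs' [of e1 v] labs' [of e2 v] labs' [of e3 v] e v(1) Fano
      unfolding M Fano_def mem_Collect_eq insert_iff empty_iff prod.inject by (smt (verit))
  qed
qed

section \<open>Independent blocks in product distributions\<close>

text \<open>An elementary form of measurability with respect to the coordinates in \<open>A\<close>;
  disjoint coordinate sets then give independence.\<close>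

definition depends_on :: "(('a \<Rightarrow> 'b) \<Rightarrow> 'c) \<Rightarrow> 'a set \<Rightarrow> bool" where
  "depends_on F A \<longleftrightarrow> (\<forall>f g. (\<forall>x\<in>A. f x = g x) \<longrightarrow> F f = F g)"

lemma depends_on_mono: "depends_on F A \<Longrightarrow> A \<subseteq> B \<Longrightarrow> depends_on F B"
  unfolding depends_on_def by (meson subsetD)

lemma nn_integral_Pi_pmf_split:
  fixes F G :: "('a \<Rightarrow> 'b) \<Rightarrow> ennreal"
  assumes "finite D" "A \<subseteq> D" and F: "depends_on F A" and G: "depends_on G (D - A)"
  shows "(\<integral>\<^sup>+f. F f * G f \<partial>Pi_pmf D d p) = (\<integral>\<^sup>+f. F f \<partial>Pi_pmf A d p) * (\<integral>\<^sup>+f. G f \<partial>Pi_pmf (D - A) d p)"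
proof -
  let ?m = "\<lambda>(f, g) x. if x \<in> A then f x else g x"
  have D: "D = A \<union> (D - A)" using assms by auto
  have "finite A" using assms finite_subset by auto
  have Pi: "Pi_pmf D d p = map_pmf ?m (pair_pmf (Pi_pmf A d p) (Pi_pmf (D - A) d p))"
    by (subst D, rule Pi_pmf_union) (use assms \<open>finite A\<close> in auto)
  have F': "F (\<lambda>x. if x \<in> A then f x else g x) = F f" for f g
    by (rule F [unfolded depends_on_def, rule_format]) simp
  have G': "G (\<lambda>x. if x \<in> A then f x else g x) = G g" for f g
    by (rule G [unfolded depends_on_def, rule_format]) simp
  have "(\<integral>\<^sup>+f. F f * G f \<partial>Pi_pmf D d p) =
      (\<integral>\<^sup>+x. F (fst x) * G (snd x) \<partial>pair_pmf (Pi_pmf A d p) (Pi_pmf (D - A) d p))"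
    unfolding Pi nn_integral_map_pmf by (simp add: case_prod_unfold F' G')
  also have "\<dots> = (\<integral>\<^sup>+f. F f \<partial>Pi_pmf A d p) * (\<integral>\<^sup>+f. G f \<partial>Pi_pmf (D - A) d p)"
    by (simp add: nn_integral_pair_pmf' nn_integral_cmult nn_integral_multc)
  finally show ?thesis .
qed

text \<open>Two further uses of the splitting formula, with one factor constantly 1, turn the
  marginal integrals into integrals over the whole product.\<close>

lemma nn_integral_Pi_pmf_mult:
  fixes F G :: "('a \<Rightarrow> 'b) \<Rightarrow> ennreal"
  assumes "finite D" "A \<subseteq> D" and F: "depends_on F A" and G: "depends_on G (D - A)"
  shows "(\<integral>\<^sup>+f. F f * G f \<partial>Pi_pmf D d p) = (\<integral>\<^sup>+f. F f \<partial>Pi_pmf D d p) * (\<integral>\<^sup>+f. G f \<partial>Pi_pmf D d p)"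
proof -
  have c: "depends_on (\<lambda>_. 1 :: ennreal) B" for B :: "'a set" by (simp add: depends_on_def)
  show ?thesis
    using nn_integral_Pi_pmf_split [OF assms, of d p] nn_integral_Pi_pmf_split [OF assms(1,2) F c, of d p]
      nn_integral_Pi_pmf_split [OF assms(1,2) c G, of d p]
    by (simp add: measure_pmf.emeasure_space_1)
qed

lemma nn_integral_Pi_pmf_prod:
  fixes F :: "'i \<Rightarrow> ('a \<Rightarrow> 'b) \<Rightarrow> ennreal"
  assumes "finite D" "finite I" and B: "\<And>i. i \<in> I \<Longrightarrow> B i \<subseteq> D" "disjoint_family_on B I"
    and F: "\<And>i. i \<in> I \<Longrightarrow> depends_on (F i) (B i)"
  shows "(\<integral>\<^sup>+f. (\<Prod>i\<in>I. F i f) \<partial>Pi_pmf D d p) = (\<Prod>i\<in>I. \<integral>\<^sup>+f. F i f \<partial>Pi_pmf D d p)"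
  using assms(2) B F
proof (induction I rule: finite_induct)
  case empty
  then show ?case by (simp add: measure_pmf.emeasure_space_1)
next
  case (insert i I)
  have "depends_on (\<lambda>f. \<Prod>j\<in>I. F j f) (D - B i)"
    unfolding depends_on_def
  proof (intro allI impI prod.cong refl)
    fix f g :: "'a \<Rightarrow> 'b" and j assume fg: "\<forall>x\<in>D - B i. f x = g x" and j: "j \<in> I"
    have "B j \<subseteq> D - B i" using insert j by (auto simp: disjoint_family_on_def)
    then show "F j f = F j g" using insert.prems(3) [of j] j fg unfolding depends_on_def by blast
  qed
  then have "(\<integral>\<^sup>+f. (\<Prod>i\<in>insert i I. F i f) \<partial>Pi_pmf D d p) =
     (\<integral>\<^sup>+f. F i f \<partial>Pi_pmf D d p) * (\<integral>\<^sup>+f. (\<Prod>j\<in>I. F j f) \<partial>Pi_pmf D d p)"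
    using insert nn_integral_Pi_pmf_mult [OF \<open>finite D\<close>, of "B i" "F i" "\<lambda>f. \<Prod>j\<in>I. F j f" d p] by simp
  also have "(\<integral>\<^sup>+f. (\<Prod>j\<in>I. F j f) \<partial>Pi_pmf D d p) = (\<Prod>i\<in>I. \<integral>\<^sup>+f. F i f \<partial>Pi_pmf D d p)"
    using insert.prems by (intro insert.IH) (auto simp: disjoint_family_on_def)
  finally show ?case using insert.hyps by simp
qed

lemma prob_Pi_pmf_all:
  fixes P :: "'i \<Rightarrow> ('a \<Rightarrow> 'b) \<Rightarrow> bool"
  assumes "finite D" "finite I" and B: "\<And>i. i \<in> I \<Longrightarrow> B i \<subseteq> D" "disjoint_family_on B I"
    and P: "\<And>i. i \<in> I \<Longrightarrow> depends_on (P i) (B i)"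
  shows "measure_pmf.prob (Pi_pmf D d p) {f. \<forall>i\<in>I. P i f} = (\<Prod>i\<in>I. measure_pmf.prob (Pi_pmf D d p) {f. P i f})"
proof -
  let ?M = "Pi_pmf D d p"
  have "ennreal (measure_pmf.prob ?M {f. \<forall>i\<in>I. P i f}) = (\<integral>\<^sup>+f. indicator {f. \<forall>i\<in>I. P i f} f \<partial>?M)"
    by (simp add: measure_pmf.emeasure_eq_measure)
  also have "\<dots> = (\<integral>\<^sup>+f. (\<Prod>i\<in>I. indicator {f. P i f} f) \<partial>?M)"
    using assms(2) by (intro nn_integral_cong) (auto simp: indicator_def)
  also have "\<dots> = (\<Prod>i\<in>I. \<integral>\<^sup>+f. indicator {f. P i f} f \<partial>?M)"
    using P by (intro nn_integral_Pi_pmf_prod [OF assms(1,2) B])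
      (auto simp: depends_on_def indicator_def)
  also have "\<dots> = ennreal (\<Prod>i\<in>I. measure_pmf.prob ?M {f. P i f})"
    by (simp add: measure_pmf.emeasure_eq_measure prod_ennreal)
  finally show ?thesis by (simp add: prod_nonneg)
qed

lemma prob_Pi_pmf_conj:
  assumes "finite D" "A \<subseteq> D" and P: "depends_on P A" and Q: "depends_on Q (D - A)"
  shows "measure_pmf.prob (Pi_pmf D d p) {f. P f \<and> Q f} =
    measure_pmf.prob (Pi_pmf D d p) {f. P f} * measure_pmf.prob (Pi_pmf D d p) {f. Q f}"
proof -
  have "measure_pmf.prob (Pi_pmf D d p) {f. \<forall>i\<in>UNIV. (if i then P else Q) f} =
     (\<Prod>i\<in>UNIV. measure_pmf.prob (Pi_pmf D d p) {f. (if i then P else Q) f})"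
    by (rule prob_Pi_pmf_all [where B = "\<lambda>i. if i then A else D - A"])
      (use assms in \<open>auto simp: disjoint_family_on_def\<close>)
  moreover have "{f. \<forall>i\<in>UNIV. (if i then P else Q) f} = {f. P f \<and> Q f}"
    by (auto split: if_splits)
  ultimately show ?thesis by (simp add: UNIV_bool)
qed

text \<open>Follows from the expectation of \<open>(1 / 2) ^ X\<close>, where \<open>X\<close> counts the events that occur.\<close>

lemma prob_Pi_pmf_few:
  fixes P :: "'i \<Rightarrow> ('a \<Rightarrow> 'b) \<Rightarrow> bool"
  assumes "finite D" "finite I" and B: "\<And>i. i \<in> I \<Longrightarrow> B i \<subseteq> D" "disjoint_family_on B I"
    and P: "\<And>i. i \<in> I \<Longrightarrow> depends_on (P i) (B i)"
    and a: "0 \<le> a" "a \<le> 1" "\<And>i. i \<in> I \<Longrightarrow> a \<le> measure_pmf.prob (Pi_pmf D d p) {f. P i f}"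
  shows "measure_pmf.prob (Pi_pmf D d p) {f. card {i\<in>I. P i f} \<le> t} \<le> 2 ^ t * (1 - a / 2) ^ card I"
proof -
  let ?M = "Pi_pmf D d p" and ?F = "\<lambda>i f. if P i f then ennreal (1 / 2) else 1"
  have pw: "indicator {f. card {i\<in>I. P i f} \<le> t} f \<le> ennreal (2 ^ t) * (\<Prod>i\<in>I. ?F i f)" for f
  proof (cases "card {i\<in>I. P i f} \<le> t")
    case True
    have "(\<Prod>i\<in>I. ?F i f) = (\<Prod>i\<in>{i\<in>I. P i f}. ennreal (1 / 2))"
      using assms(2) by (subst prod.inter_filter) (auto intro: prod.cong)
    also have "\<dots> = ennreal ((1 / 2) ^ card {i\<in>I. P i f})"
      unfolding prod_constant by (rule ennreal_power) simp
    finally have "ennreal (2 ^ t) * (\<Prod>i\<in>I. ?F i f) = ennreal (2 ^ t * (1 / 2) ^ card {i\<in>I. P i f})"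
      by (simp add: ennreal_mult)
    moreover have "(1 :: real) = 2 ^ t * (1 / 2) ^ t" by (simp add: power_divide)
    moreover have "(1 / 2 :: real) ^ t \<le> (1 / 2) ^ card {i\<in>I. P i f}"
      using True by (intro power_decreasing) auto
    then have "(2 :: real) ^ t * (1 / 2) ^ t \<le> 2 ^ t * (1 / 2) ^ card {i\<in>I. P i f}"
      by (intro mult_left_mono) auto
    ultimately show ?thesis by (simp add: indicator_def)
  qed simp
  have one: "(\<integral>\<^sup>+f. ?F i f \<partial>?M) \<le> ennreal (1 - a / 2)" if i: "i \<in> I" for i
  proof -
    have "(\<integral>\<^sup>+f. ?F i f \<partial>?M) = (\<integral>\<^sup>+f. ennreal (1 / 2) * indicator {f. P i f} f + indicator {f. \<not> P i f} f \<partial>?M)"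
      by (intro nn_integral_cong) (auto simp: indicator_def)
    also have "\<dots> = ennreal (1 / 2) * emeasure ?M {f. P i f} + emeasure ?M {f. \<not> P i f}"
      by (subst nn_integral_add) (auto simp: nn_integral_cmult)
    also have "\<dots> = ennreal (1 / 2 * measure_pmf.prob ?M {f. P i f} + measure_pmf.prob ?M {f. \<not> P i f})"
      unfolding measure_pmf.emeasure_eq_measure
      by (subst ennreal_plus, simp, simp, subst ennreal_mult, simp, simp, rule refl)
    also have "measure_pmf.prob ?M {f. \<not> P i f} = 1 - measure_pmf.prob ?M {f. P i f}"
      using measure_pmf.prob_compl [of "{f. P i f}" ?M] by (simp add: Collect_neg_eq Compl_eq_Diff_UNIV)
    also have "ennreal (1 / 2 * measure_pmf.prob ?M {f. P i f} + (1 - measure_pmf.prob ?M {f. P i f})) \<le> ennreal (1 - a / 2)"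
      using a(3) [OF i] by (intro ennreal_leI) (simp add: field_simps)
    finally show ?thesis .
  qed
  have "ennreal (measure_pmf.prob ?M {f. card {i\<in>I. P i f} \<le> t}) = (\<integral>\<^sup>+f. indicator {f. card {i\<in>I. P i f} \<le> t} f \<partial>?M)"
    by (simp add: measure_pmf.emeasure_eq_measure)
  also have "\<dots> \<le> (\<integral>\<^sup>+f. ennreal (2 ^ t) * (\<Prod>i\<in>I. ?F i f) \<partial>?M)"
    by (intro nn_integral_mono pw)
  also have "\<dots> = ennreal (2 ^ t) * (\<integral>\<^sup>+f. (\<Prod>i\<in>I. ?F i f) \<partial>?M)"
    by (subst nn_integral_cmult) auto
  also have "(\<integral>\<^sup>+f. (\<Prod>i\<in>I. ?F i f) \<partial>?M) = (\<Prod>i\<in>I. \<integral>\<^sup>+f. ?F i f \<partial>?M)"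
  proof (rule nn_integral_Pi_pmf_prod [OF assms(1,2) B])
    show "depends_on (?F i) (B i)" if "i \<in> I" for i
      using P [OF that] unfolding depends_on_def by metis
  qed
  also have "\<dots> \<le> (\<Prod>i\<in>I. ennreal (1 - a / 2))" using assms(2) one
    by (induction I rule: finite_induct) (auto intro: mult_mono)
  also have "\<dots> = ennreal ((1 - a / 2) ^ card I)" using a by (simp add: ennreal_power)
  also have "ennreal (2 ^ t) * \<dots> = ennreal (2 ^ t * (1 - a / 2) ^ card I)"
    using a by (subst ennreal_mult) auto
  finally show ?thesis using a by (simp add: mult_left_mono ennreal_le_iff)
qed

section \<open>Expansion of random graphs\<close>

abbreviation rand_edges :: "nat \<Rightarrow> real \<Rightarrow> (nat set \<Rightarrow> bool) pmf" where
  "rand_edges n p \<equiv> Pi_pmf (all_edges {..<n}) False (\<lambda>_. bernoulli_pmf p)"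

definition present :: "nat \<Rightarrow> (nat set \<Rightarrow> bool) \<Rightarrow> nat \<Rightarrow> nat \<Rightarrow> bool" where
  "present n f u v \<longleftrightarrow> {u, v} \<in> all_edges {..<n} \<and> f {u, v}"

lemma finite_all_edges: "finite V \<Longrightarrow> finite (all_edges V)"
  unfolding all_edges_def by simp

lemma pair_in_all_edges: "{u, v} \<in> all_edges V \<longleftrightarrow> u \<in> V \<and> v \<in> V \<and> u \<noteq> v"
  by (auto simp: all_edges_def card_insert_if)

lemma prob_all_edges_in:
  assumes S: "S \<subseteq> all_edges {..<n}" and p: "0 \<le> p" "p \<le> 1"
  shows "measure_pmf.prob (rand_edges n p) {f. \<forall>e\<in>S. f e} = p ^ card S" (is ?in)
    and "measure_pmf.prob (rand_edges n p) {f. \<forall>e\<in>S. \<not> f e} = (1 - p) ^ card S" (is ?out)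
proof -
  have fin: "finite (all_edges {..<n})" "finite S" using S finite_all_edges finite_subset by auto
  have one: "measure_pmf.prob (rand_edges n p) {f. f e = b} = (if b then p else 1 - p)" if "e \<in> S" for e b
  proof -
    have "measure_pmf.prob (rand_edges n p) {f. f e = b} = measure_pmf.prob (map_pmf (\<lambda>f. f e) (rand_edges n p)) {b}"
      by (simp add: vimage_def)
    also have "map_pmf (\<lambda>f. f e) (rand_edges n p) = bernoulli_pmf p"
      using that S fin by (subst Pi_pmf_component) auto
    finally show ?thesis using p by (auto simp: measure_pmf_single)
  qed
  have "measure_pmf.prob (rand_edges n p) {f. \<forall>e\<in>S. f e = b} = (\<Prod>e\<in>S. measure_pmf.prob (rand_edges n p) {f. f e = b})" for b
    using S by (intro prob_Pi_pmf_all [OF fin, of "\<lambda>e. {e}"]) (auto simp: disjoint_family_on_def depends_on_def)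
  also have "\<dots> b = (if b then p else 1 - p) ^ card S" for b
    using one by simp
  finally have "measure_pmf.prob (rand_edges n p) {f. \<forall>e\<in>S. f e = b} = (if b then p else 1 - p) ^ card S" for b .
  from this [of True] this [of False] show ?in ?out by simp_all
qed

lemma card_subsets_le: "finite V \<Longrightarrow> card {X. X \<subseteq> V \<and> card X = k} \<le> card V ^ k"
  by (cases "k \<le> card V") (simp_all add: n_subsets binomial_le_pow binomial_eq_0)

lemma prob_no_edge_between:
  assumes p: "0 \<le> p" "p \<le> 1"
  shows "measure_pmf.prob (rand_edges n p) {f. \<exists>X Y. X \<subseteq> {..<n} \<and> Y \<subseteq> {..<n} \<and> X \<inter> Y = {} \<and>
     card X = L \<and> card Y = L \<and> (\<forall>x\<in>X. \<forall>y\<in>Y. \<not> present n f x y)} \<le> real n ^ (2 * L) * (1 - p) ^ (L * L)"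
proof -
  let ?S = "{X. X \<subseteq> {..<n} \<and> card X = L}"
  let ?I = "{(X, Y). X \<in> ?S \<and> Y \<in> ?S \<and> X \<inter> Y = {}}"
  let ?ev = "\<lambda>(X, Y). {f. \<forall>x\<in>X. \<forall>y\<in>Y. \<not> present n f x y}"
  have sub: "?I \<subseteq> ?S \<times> ?S" by auto
  have finI: "finite ?I" by (rule finite_subset [OF sub]) simp
  have "card ?I \<le> card (?S \<times> ?S)" by (rule card_mono [OF _ sub]) simp
  also have "\<dots> \<le> n ^ L * n ^ L"
    using card_subsets_le [of "{..<n}" L] by (simp add: card_cartesian_product mult_mono)
  finally have "card ?I \<le> n ^ (2 * L)" by (simp add: power_add [symmetric] mult_2)
  then have cI: "real (card ?I) \<le> real n ^ (2 * L)"
    unfolding of_nat_power [symmetric] of_nat_le_iff .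
  have one: "measure_pmf.prob (rand_edges n p) (?ev XY) \<le> (1 - p) ^ (L * L)" if XY_in: "XY \<in> ?I" for XY
  proof -
    obtain X Y where XY: "XY = (X, Y)" "X \<subseteq> {..<n}" "card X = L" "Y \<subseteq> {..<n}" "card Y = L" "X \<inter> Y = {}"
      using XY_in by auto
    let ?E = "(\<lambda>(x, y). {x, y}) ` (X \<times> Y)"
    \<comment> \<open>Disjointness of \<open>X\<close> and \<open>Y\<close> makes the
      \<open>L * L\<close> pairs distinct edges.\<close>
    have inj: "inj_on (\<lambda>(x, y). {x, y}) (X \<times> Y)"
      using XY(6) by (fastforce simp: inj_on_def doubleton_eq_iff)
    have c: "card ?E = L * L" using XY by (simp add: card_image [OF inj] card_cartesian_product)
    have E: "?E \<subseteq> all_edges {..<n}" using XY by (auto simp: pair_in_all_edges)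
    have "?ev XY = {f. \<forall>e\<in>?E. \<not> f e}"
      using E unfolding XY(1) present_def by auto
    then show ?thesis using prob_all_edges_in(2) [OF E p] c by simp
  qed
  have "measure_pmf.prob (rand_edges n p) {f. \<exists>X Y. X \<subseteq> {..<n} \<and> Y \<subseteq> {..<n} \<and> X \<inter> Y = {} \<and>
     card X = L \<and> card Y = L \<and> (\<forall>x\<in>X. \<forall>y\<in>Y. \<not> present n f x y)} \<le>
     measure_pmf.prob (rand_edges n p) (\<Union>XY\<in>?I. ?ev XY)"
    by (intro measure_pmf.finite_measure_mono) auto
  also have "\<dots> \<le> (\<Sum>XY\<in>?I. measure_pmf.prob (rand_edges n p) (?ev XY))"
    by (intro measure_pmf.finite_measure_subadditive_finite finI) auto
  also have "\<dots> \<le> (\<Sum>XY\<in>?I. (1 - p) ^ (L * L))" by (intro sum_mono one)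
  also have "\<dots> = real (card ?I) * (1 - p) ^ (L * L)" by simp
  also have "\<dots> \<le> real n ^ (2 * L) * (1 - p) ^ (L * L)"
    using cI p by (intro mult_right_mono) auto
  finally show ?thesis .
qed

text \<open>With \<open>y = m * p\<close>, Bernoulli's inequality gives
  \<open>(1 - p) ^ m * (1 + y) <= (1 - p * p) ^ m <= 1\<close>, and
  \<open>1 <= (1 - y / 2) * (1 + y)\<close> because \<open>y <= 1\<close>.\<close>

lemma one_minus_power_le:
  fixes p :: real
  assumes p: "0 \<le> p" "p \<le> 1" and mp: "real m * p \<le> 1"
  shows "(1 - p) ^ m \<le> 1 - real m * p / 2"
proof -
  let ?y = "real m * p"
  have "(1 - p) ^ m * (1 + ?y) \<le> (1 - p) ^ m * (1 + p) ^ m"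
    using p Bernoulli_inequality [of p m] by (intro mult_left_mono) auto
  also have "\<dots> = (1 - p * p) ^ m" by (simp add: power_mult_distrib [symmetric] algebra_simps)
  also have "\<dots> \<le> 1" using p by (intro power_le_one) (auto simp: mult_le_one)
  also have "1 \<le> (1 - ?y / 2) * (1 + ?y)"
  proof -
    have "?y * ?y \<le> ?y" using mp p by (intro mult_left_le_one_le) auto
    then show ?thesis by (simp add: algebra_simps)
  qed
  finally have "(1 - p) ^ m * (1 + ?y) \<le> (1 - ?y / 2) * (1 + ?y)" .
  moreover have "0 < 1 + ?y" using p by (simp add: add_pos_nonneg)
  ultimately show ?thesis by (rule mult_right_le_imp_le)
qed

text \<open>A vertex outside \<open>S\<close> and \<open>M\<close> qualifies with probability at
  least \<open>p ^ 3 * (card M * p / 2)\<close>; the bound \<open>card M * p <= 1\<close> keeps the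
  chance of meeting \<open>M\<close> linear in \<open>card M\<close>. Different vertices look at
  disjoint sets of edges, so \<open>prob_Pi_pmf_few\<close> applies, and at most
  \<open>3 + card M\<close> vertices are left aside.\<close>

lemma prob_few_common_nbs:
  assumes p: "0 \<le> p" "p \<le> 1" and S: "S \<subseteq> {..<n}" "card S \<le> 3"
    and M: "M \<subseteq> {..<n}" "M \<noteq> {}" "real (card M) * p \<le> 1"
  shows "measure_pmf.prob (rand_edges n p) {f. card (common_nbs (present n f) {..<n} S M) \<le> t}
    \<le> 2 ^ t * (1 - p ^ 4 * card M / 4) ^ (n - 3 - card M)"
proof -
  let ?D = "all_edges {..<n}" and ?m = "card M"
  let ?a = "p ^ 4 * ?m / 2"
  define U where "U = {..<n} - (S \<union> M)"
  have fin: "finite ?D" "finite S" "finite M" "finite U"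
    using finite_all_edges [of "{..<n}"] finite_subset [OF S(1)] finite_subset [OF M(1)] by (simp_all add: U_def)
  define P where "P v f \<longleftrightarrow> (\<forall>s\<in>S. f {s, v}) \<and> (\<exists>m\<in>M. f {m, v})" for v and f :: "nat set \<Rightarrow> bool"
  let ?B = "\<lambda>v. (\<lambda>s. {s, v}) ` (S \<union> M)"
  have BD: "?B v \<subseteq> ?D" if "v \<in> U" for v
    using that S M by (auto simp: U_def pair_in_all_edges)
  have disj: "disjoint_family_on ?B U"
    by (auto simp: disjoint_family_on_def U_def doubleton_eq_iff)
  have dep: "depends_on (P v) (?B v)" for v
    unfolding depends_on_def P_def by (metis (no_types, lifting) UnCI image_eqI)
  have m1: "1 \<le> ?m" using M fin by (simp add: Suc_le_eq card_gt_0_iff)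
  have p4: "p ^ 4 * ?m = p ^ 3 * (?m * p)" by (simp add: power4_eq_xxxx power3_eq_cube)
  have mp0: "0 \<le> real ?m * p" using p by simp
  have a1: "?a \<le> p ^ 3"
  proof -
    have "p ^ 3 * (real ?m * p) \<le> p ^ 3 * 1" using p M(3) by (intro mult_left_mono) auto
    moreover have "0 \<le> p ^ 3" using p by simp
    ultimately show ?thesis unfolding p4 by linarith
  qed
  have prob: "?a \<le> measure_pmf.prob (rand_edges n p) {f. P v f}" if v: "v \<in> U" for v
  proof -
    let ?ES = "(\<lambda>s. {s, v}) ` S" and ?EM = "(\<lambda>s. {s, v}) ` M"
    have inj: "inj_on (\<lambda>s. {s, v}) (S \<union> M)" by (auto simp: inj_on_def doubleton_eq_iff)
    have cS: "card ?ES = card S" and cM: "card ?EM = ?m"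
      using inj by (auto intro!: card_image simp: inj_on_Un)
    have ES: "?ES \<subseteq> ?D" and EM: "?EM \<subseteq> ?D" using BD [OF v] by auto
    have pS: "p ^ 3 \<le> p ^ card S" using p S by (intro power_decreasing) auto
    have allS: "measure_pmf.prob (rand_edges n p) {f. \<forall>s\<in>S. f {s, v}} = p ^ card S"
      using prob_all_edges_in(1) [OF ES p] cS by simp
    show ?thesis
    proof (cases "S \<inter> M = {}")
      case True
      have "measure_pmf.prob (rand_edges n p) {f. \<exists>m\<in>M. f {m, v}} =
          1 - measure_pmf.prob (rand_edges n p) {f. \<forall>e\<in>?EM. \<not> f e}"
        using measure_pmf.prob_compl [of "{f. \<forall>e\<in>?EM. \<not> f e}" "rand_edges n p"]
        by (simp add: Compl_eq_Diff_UNIV [symmetric] Collect_neg_eq [symmetric])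
      also have "\<dots> = 1 - (1 - p) ^ ?m" using prob_all_edges_in(2) [OF EM p] cM by simp
      also have "\<dots> \<ge> real ?m * p / 2" using one_minus_power_le [OF p M(3)] by simp
      finally have exM: "real ?m * p / 2 \<le> measure_pmf.prob (rand_edges n p) {f. \<exists>m\<in>M. f {m, v}}" .
      have "measure_pmf.prob (rand_edges n p) {f. P v f} = measure_pmf.prob (rand_edges n p) {f. \<forall>s\<in>S. f {s, v}} *
          measure_pmf.prob (rand_edges n p) {f. \<exists>m\<in>M. f {m, v}}"
        unfolding P_def
      proof (rule prob_Pi_pmf_conj [OF fin(1) ES])
        show "depends_on (\<lambda>f. \<forall>s\<in>S. f {s, v}) ?ES" by (auto simp: depends_on_def)
        have "depends_on (\<lambda>f. \<exists>m\<in>M. f {m, v}) ?EM" by (auto simp: depends_on_def)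
        moreover have "?EM \<subseteq> ?D - ?ES" using EM True by (auto simp: doubleton_eq_iff)
        ultimately show "depends_on (\<lambda>f. \<exists>m\<in>M. f {m, v}) (?D - ?ES)" by (rule depends_on_mono)
      qed
      also have "\<dots> \<ge> p ^ 3 * (real ?m * p / 2)"
        unfolding allS using pS exM mp0 p by (intro mult_mono) auto
      finally show ?thesis unfolding p4 by simp
    next
      \<comment> \<open>A neighbour in \<open>M\<close> comes for free here, and
        \<open>p ^ 3\<close> alone is at least \<open>?a\<close>.\<close>
      case False
      then have "{f. P v f} = {f. \<forall>s\<in>S. f {s, v}}" by (auto simp: P_def)
      then show ?thesis using allS pS a1 by simp
    qed
  qed
  have "card {v\<in>U. P v f} \<le> card (common_nbs (present n f) {..<n} S M)" for f
    using S M by (intro card_mono) (auto simp: common_nbs_def U_def P_def present_def pair_in_all_edges)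
  then have "measure_pmf.prob (rand_edges n p) {f. card (common_nbs (present n f) {..<n} S M) \<le> t} \<le>
      measure_pmf.prob (rand_edges n p) {f. card {v\<in>U. P v f} \<le> t}"
    by (intro measure_pmf.finite_measure_mono) (auto intro: order_trans)
  also have "\<dots> \<le> 2 ^ t * (1 - ?a / 2) ^ card U"
    using p a1 power_le_one [OF p, of 3] fin BD disj dep prob
    by (intro prob_Pi_pmf_few [where B = ?B]) auto
  also have "\<dots> \<le> 2 ^ t * (1 - ?a / 2) ^ (n - 3 - card M)"
  proof -
    have "card U = n - card (S \<union> M)" using S M fin by (simp add: U_def card_Diff_subset)
    moreover have "card (S \<union> M) \<le> 3 + card M" using card_Un_le [of S M] S by linarith
    ultimately show ?thesis using p a1 power_le_one [OF p, of 3]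
      by (intro mult_left_mono power_decreasing) auto
  qed
  finally show ?thesis by simp
qed

section \<open>Union bounds in the dense regime\<close>

lemma prob_UN_le_sum:
  assumes "finite I" "\<And>i. i \<in> I \<Longrightarrow> measure_pmf.prob M (A i) \<le> b i"
  shows "measure_pmf.prob M (\<Union>i\<in>I. A i) \<le> (\<Sum>i\<in>I. b i)"
proof -
  have "measure_pmf.prob M (\<Union>i\<in>I. A i) \<le> (\<Sum>i\<in>I. measure_pmf.prob M (A i))"
    using assms(1) by (intro measure_pmf.finite_measure_subadditive_finite) auto
  also have "\<dots> \<le> (\<Sum>i\<in>I. b i)" by (intro sum_mono assms(2))
  finally show ?thesis .
qed

text \<open>The constant is \<open>100 ^ 4\<close>, from the factor 100 in front of the threshold
  function. The bound on \<open>n\<close> yields \<open>1 <= ln n\<close> and helps to ensure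
  \<open>n / 2 <= n - 3 - card M\<close> for \<open>card M <= q\<close>.\<close>

locale dense_regime =
  fixes n :: nat and p :: real
  assumes n: "12 \<le> n" and p: "0 < p" "p \<le> 1" and dense: "100000000 * ln n \<le> n * p ^ 4"
begin

text \<open>Edges join any two sets of size \<open>L\<close>, and sets of up to \<open>q\<close> vertices expand by \<open>factor\<close>. Since
  \<open>4251528 = 8 * 27 ^ 4\<close>, a set of size \<open>q\<close> reaches the size \<open>27 ^ 4 * L\<close> required by
  \<open>three_labels_cover\<close>.\<close>

definition q :: nat where "q = nat \<lfloor>1 / p\<rfloor>"
definition factor :: nat where "factor = nat \<lceil>4251528 * ln n\<rceil>"
definition L :: nat where "L = nat \<lceil>3 * ln n / p\<rceil>"

lemma ln_ge_1: "1 \<le> ln (real n)"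
proof -
  have "exp 1 \<le> real n" using exp_le n by linarith
  then show ?thesis using n by (subst ln_ge_iff) auto
qed

lemma q_le: "real q \<le> 1 / p" using p by (simp add: q_def)

lemma q_ge: "1 / (2 * p) \<le> real q"
proof -
  have x: "1 \<le> 1 / p" using p by simp
  then have "1 \<le> \<lfloor>1 / p\<rfloor>" by (subst le_floor_iff) simp
  then have "1 \<le> real q" unfolding q_def by linarith
  moreover have "1 / p < real q + 1" unfolding q_def using x by linarith
  ultimately have "1 / p \<le> 2 * real q" by linarith
  then show ?thesis using p by (simp add: field_simps)
qed

lemma q_le_n: "100000000 * real q \<le> real n"
proof -
  have "p ^ 4 \<le> p ^ 1" using p by (intro power_decreasing) auto
  then have "100000000 * 1 \<le> real n * p"
    using dense ln_ge_1 mult_left_mono [of "p ^ 4" p "real n"] by simp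
  then have "100000000 * (1 / p) \<le> real n" using p by (simp add: field_simps)
  then show ?thesis using q_le by linarith
qed

lemma prob_few_common_nbs_dense:
  assumes S: "S \<subseteq> {..<n}" "card S \<le> 3" and M: "M \<subseteq> {..<n}" "M \<noteq> {}" "card M \<le> q"
  shows "measure_pmf.prob (rand_edges n p) {f. card (common_nbs (present n f) {..<n} S M) \<le> factor * card M}
    \<le> (1 / real n ^ 8) ^ card M"
proof -
  let ?m = "card M"
  have "real ?m \<le> 1 / p" using M(3) q_le by linarith
  then have mp: "real ?m * p \<le> 1" using p by (simp add: field_simps)
  let ?x = "p ^ 4 * ?m / 4"
  have "p ^ 4 * ?m = p ^ 3 * (?m * p)" by (simp add: power4_eq_xxxx power3_eq_cube)
  also have "\<dots> \<le> 1 * 1" using p mp by (intro mult_mono power_le_one) auto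
  finally have x: "0 \<le> ?x" "?x \<le> 1" using p by auto
  have fac: "real factor \<le> 4251529 * ln n"
    using ln_ge_1 unfolding factor_def by linarith
  have "measure_pmf.prob (rand_edges n p) {f. card (common_nbs (present n f) {..<n} S M) \<le> factor * card M}
    \<le> 2 ^ (factor * ?m) * (1 - ?x) ^ (n - 3 - ?m)"
    using prob_few_common_nbs [OF _ p(2) S M(1,2) mp] p by simp
  also have "\<dots> \<le> exp 1 ^ (factor * ?m) * exp (- ?x) ^ (n - 3 - ?m)"
    using x exp_ge_add_one_self [of 1] exp_ge_add_one_self [of "- ?x"]
    by (intro mult_mono power_mono) auto
  also have "\<dots> = exp (real factor * ?m - ?x * real (n - 3 - ?m))"
    by (simp add: exp_of_nat_mult [symmetric] exp_add [symmetric] algebra_simps)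
  \<comment> \<open>Per element of \<open>M\<close>, the power of 2 costs at most
    \<open>4251529 * ln n\<close> in the exponent, while the other power gains
    \<open>100000000 / 8 = 12500000\<close> times \<open>ln n\<close>. Of the surplus, 8 is kept for
    the union bound.\<close>
  also have "\<dots> \<le> exp (- (8 * ln n * ?m))"
  proof -
    have "100000000 * real ?m \<le> real n" using M(3) q_le_n by (smt (verit) mult_left_mono of_nat_mono zero_le_power)
    then have "real n / 2 \<le> real (n - 3 - ?m)" using n by linarith
    then have "?x * (real n / 2) \<le> ?x * real (n - 3 - ?m)" using x by (intro mult_left_mono) auto
    moreover have "100000000 * ln n * real ?m \<le> n * p ^ 4 * real ?m" using dense by (intro mult_right_mono) auto
    then have "(12500000) * (ln n * real ?m) \<le> ?x * (real n / 2)" by (simp add: field_simps)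
    moreover have "real factor * ?m \<le> 4251529 * ln n * ?m" using fac by (intro mult_right_mono) auto
    moreover have "0 \<le> ln n * real ?m" using ln_ge_1 by simp
    ultimately have "real factor * ?m - ?x * real (n - 3 - ?m) \<le> - (8 * (ln n * ?m))" by (simp add: algebra_simps)
    then show ?thesis by simp
  qed
  also have "\<dots> = (1 / real n ^ 8) ^ ?m"
  proof -
    have "exp (- (8 * ln n * ?m)) = exp (- (8 * ln n)) ^ ?m" by (simp add: exp_of_nat2_mult [symmetric])
    also have "exp (- (8 * ln n)) = 1 / real n ^ 8"
      using n exp_of_nat_mult [of 8 "ln (real n)"] by (simp add: exp_minus field_simps)
    finally show ?thesis .
  qed
  finally show ?thesis .
qed

text \<open>For given sizes, at most \<open>n ^ 3 * n ^ m\<close> pairs face a failure probability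
  of \<open>n ^ (- 8 * m)\<close> each, which leaves at most \<open>n ^ (- 4)\<close> as
  \<open>m >= 1\<close>; there are \<open>4 * q\<close> pairs of sizes.\<close>

lemma prob_not_expanding:
  "measure_pmf.prob (rand_edges n p) {f. \<exists>S M. S \<subseteq> {..<n} \<and> card S \<le> 3 \<and> M \<subseteq> {..<n} \<and> M \<noteq> {} \<and>
     card M \<le> q \<and> card (common_nbs (present n f) {..<n} S M) \<le> factor * card M} \<le> 1 / n"
proof -
  let ?s = "\<lambda>k. {X. X \<subseteq> {..<n} \<and> card X = k}"
  let ?ev = "\<lambda>(S, M). {f. card (common_nbs (present n f) {..<n} S M) \<le> factor * card M}"
  have fin: "finite (?s k)" for k by simp
  have cs: "real (card (?s k)) \<le> real n ^ k" for k
    using card_subsets_le [of "{..<n}" k] unfolding of_nat_power [symmetric] of_nat_le_iff by simp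
  have one: "measure_pmf.prob (rand_edges n p) (\<Union>SM\<in>?s j \<times> ?s m. ?ev SM) \<le> 1 / real n ^ 4"
    if j: "j \<le> 3" and m: "m \<in> {1..q}" for j m
  proof -
    have "measure_pmf.prob (rand_edges n p) (\<Union>SM\<in>?s j \<times> ?s m. ?ev SM) \<le>
        (\<Sum>SM\<in>?s j \<times> ?s m. (1 / real n ^ 8) ^ m)"
    proof (intro prob_UN_le_sum)
      fix SM assume "SM \<in> ?s j \<times> ?s m"
      then obtain S M where SM: "SM = (S, M)" "S \<subseteq> {..<n}" "card S = j" "M \<subseteq> {..<n}" "card M = m" by auto
      then have "M \<noteq> {}" using m by auto
      then show "measure_pmf.prob (rand_edges n p) (?ev SM) \<le> (1 / real n ^ 8) ^ m"
        using prob_few_common_nbs_dense [of S M] SM j m by simp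
    qed (simp add: fin)
    also have "\<dots> = real (card (?s j)) * real (card (?s m)) * (1 / real n ^ 8) ^ m"
      by (simp add: card_cartesian_product)
    also have "\<dots> \<le> real n ^ 3 * real n ^ m * (1 / real n ^ 8) ^ m"
    proof (intro mult_right_mono mult_mono cs)
      show "real (card (?s j)) \<le> real n ^ 3"
        using power_increasing [OF j, of "real n"] n by (intro order_trans [OF cs]) simp
    qed auto
    also have "\<dots> = real n ^ 3 * (1 / real n ^ 7) ^ m"
    proof -
      have "real n * (1 / real n ^ 8) = 1 / real n ^ 7" using n by (simp add: power_eq_if)
      then show ?thesis by (simp only: mult.assoc power_mult_distrib [symmetric])
    qed
    also have "\<dots> \<le> real n ^ 3 * (1 / real n ^ 7) ^ 1"
      using m n by (intro mult_left_mono power_decreasing) auto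
    also have "\<dots> = 1 / real n ^ 4" using n by (simp add: power_eq_if)
    finally show ?thesis .
  qed
  have "measure_pmf.prob (rand_edges n p) {f. \<exists>S M. S \<subseteq> {..<n} \<and> card S \<le> 3 \<and> M \<subseteq> {..<n} \<and> M \<noteq> {} \<and>
     card M \<le> q \<and> card (common_nbs (present n f) {..<n} S M) \<le> factor * card M} \<le>
     measure_pmf.prob (rand_edges n p) (\<Union>jm\<in>{..3} \<times> {1..q}. \<Union>SM\<in>?s (fst jm) \<times> ?s (snd jm). ?ev SM)"
  proof (intro measure_pmf.finite_measure_mono subsetI)
    fix f assume "f \<in> {f. \<exists>S M. S \<subseteq> {..<n} \<and> card S \<le> 3 \<and> M \<subseteq> {..<n} \<and> M \<noteq> {} \<and>
     card M \<le> q \<and> card (common_nbs (present n f) {..<n} S M) \<le> factor * card M}"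
    then obtain S M where SM: "S \<subseteq> {..<n}" "card S \<le> 3" "M \<subseteq> {..<n}" "M \<noteq> {}" "card M \<le> q"
      "card (common_nbs (present n f) {..<n} S M) \<le> factor * card M" by blast
    have "finite M" using SM(3) finite_subset by auto
    then have "1 \<le> card M" using SM(4) by (simp add: Suc_le_eq card_gt_0_iff)
    then have "(card S, card M) \<in> {..3} \<times> {1..q}" using SM by auto
    moreover have "(S, M) \<in> ?s (card S) \<times> ?s (card M)" using SM by auto
    ultimately show "f \<in> (\<Union>jm\<in>{..3} \<times> {1..q}. \<Union>SM\<in>?s (fst jm) \<times> ?s (snd jm). ?ev SM)"
      using SM(6) by (intro UN_I [of "(card S, card M)"] UN_I [of "(S, M)"]) auto
  qed simp
  also have "\<dots> \<le> (\<Sum>jm\<in>{..3::nat} \<times> {1..q}. 1 / real n ^ 4)"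
    by (intro prob_UN_le_sum) (use one in auto)
  also have "\<dots> = 4 * real q / real n ^ 4" by (simp add: card_cartesian_product)
  also have "\<dots> \<le> real n ^ 3 / real n ^ 4"
  proof (intro divide_right_mono)
    have "real n * 1 \<le> real n * real n ^ 2" using n by (intro mult_left_mono) auto
    then have "real n \<le> real n ^ 3" by (simp add: power3_eq_cube power2_eq_square)
    then show "4 * real q \<le> real n ^ 3" using q_le_n by linarith
  qed simp
  also have "\<dots> = 1 / real n" using n by (simp add: power_eq_if)
  finally show ?thesis .
qed

lemma prob_no_edge_between_dense:
  "measure_pmf.prob (rand_edges n p) {f. \<exists>X Y. X \<subseteq> {..<n} \<and> Y \<subseteq> {..<n} \<and> X \<inter> Y = {} \<and>
     card X = L \<and> card Y = L \<and> (\<forall>x\<in>X. \<forall>y\<in>Y. \<not> present n f x y)} \<le> 1 / n" (is "?P \<le> _")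
proof -
  have "0 < 3 * ln n / p" using ln_ge_1 p by simp
  then have L: "3 * ln n / p \<le> real L" "1 \<le> L" unfolding L_def by linarith+
  have "?P \<le> real n ^ (2 * L) * (1 - p) ^ (L * L)"
    using p by (intro prob_no_edge_between) auto
  also have "\<dots> \<le> real n ^ (2 * L) * exp (- p) ^ (L * L)"
    using p exp_ge_add_one_self [of "- p"] by (intro mult_left_mono power_mono) auto
  also have "\<dots> = exp (ln n) ^ (2 * L) * exp (- p) ^ (L * L)" using n by simp
  also have "\<dots> = exp (2 * real L * ln n - p * (real L * real L))"
    by (simp only: exp_of_nat_mult [symmetric] exp_add [symmetric]) simp
  also have "\<dots> \<le> exp (- ln n)"
  proof -
    \<comment> \<open>The 3 in the definition of \<open>L\<close> exceeds by one the 2 in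
      \<open>n ^ (2 * L)\<close>, the bound for the number of pairs; this leaves
      \<open>exp (- L * ln n)\<close>.\<close>
    have "3 * ln n \<le> p * real L" using L(1) p by (simp add: field_simps)
    then have "3 * ln n * real L \<le> p * real L * real L" by (intro mult_right_mono) auto
    moreover have "ln n * 1 \<le> ln n * real L" using L(2) ln_ge_1 by (intro mult_left_mono) auto
    ultimately show ?thesis by (simp add: algebra_simps)
  qed
  also have "\<dots> = 1 / n" using n by (simp add: exp_minus field_simps)
  finally show ?thesis .
qed

lemma tc_le_3_if_expanding:
  assumes exp: "\<not> (\<exists>S M. S \<subseteq> {..<n} \<and> card S \<le> 3 \<and> M \<subseteq> {..<n} \<and> M \<noteq> {} \<and>
     card M \<le> q \<and> card (common_nbs (present n f) {..<n} S M) \<le> factor * card M)"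
    and edge: "\<not> (\<exists>X Y. X \<subseteq> {..<n} \<and> Y \<subseteq> {..<n} \<and> X \<inter> Y = {} \<and>
     card X = L \<and> card Y = L \<and> (\<forall>x\<in>X. \<forall>y\<in>Y. \<not> present n f x y))"
  shows "tc 3 ({..<n}, {e \<in> all_edges {..<n}. f e}) \<le> 3"
proof (rule tc_3_le_3)
  let ?G = "({..<n}, {e \<in> all_edges {..<n}. f e})"
  show "finite (verts ?G)" "verts ?G \<noteq> {}" using n by (auto simp: lessThan_empty_iff)
  show "simple_graph ?G" by (auto simp: simple_graph_def)
  fix c assume col: "edge_colouring 3 ?G c"
  have q0: "0 < q" using q_ge p by (metis divide_pos_pos mult_pos_pos not_gr_zero of_nat_0 not_le zero_less_numeral zero_less_one)
  have fac: "4251528 * ln n \<le> real factor" unfolding factor_def by linarith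
  have fac4: "4 \<le> factor" using ln_ge_1 unfolding factor_def by linarith
  have Lq: "27 ^ 4 * L \<le> factor * q"
  proof -
    have "1 \<le> ln n / p" using ln_ge_1 p by (simp add: field_simps)
    then have "real L \<le> 4 * (ln n / p)" unfolding L_def by linarith
    moreover have "4251528 * ln n * (1 / (2 * p)) \<le> real factor * real q"
      using fac q_ge p ln_ge_1 by (intro mult_mono) auto
    ultimately have "real (27 ^ 4 * L) \<le> real (factor * q)" by simp
    then show ?thesis by (simp only: of_nat_le_iff)
  qed
  have "0 < 3 * ln n / p" using ln_ge_1 p by simp
  then have L0: "0 < L" unfolding L_def by linarith
  have big: "factor * card M < card (common_nbs (present n f) {..<n} S M)"
    if "S \<subseteq> {..<n}" "card S \<le> 3" "M \<subseteq> {..<n}" "M \<noteq> {}" "card M \<le> q" for S M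
    using exp that by (metis not_le)
  have "\<exists>i<3. \<exists>j<3. \<exists>k<3. \<exists>a b d. \<forall>v\<in>{..<n}. mono_comp ?G c i v = a \<or> mono_comp ?G c j v = b \<or> mono_comp ?G c k v = d"
  proof (rule three_labels_cover [where adj = "present n f" and L = L and q = q])
    show "q \<le> card {..<n}" using q_le_n by simp
    show "\<exists>i<3. mono_comp ?G c i x = mono_comp ?G c i y" if "present n f x y" for x y
    proof -
      have e: "{x, y} \<in> edges ?G" using that by (simp add: present_def)
      then have "c {x, y} < 3" using col unfolding edge_colouring_def by blast
      then show ?thesis using mono_comp_eq_if_edge [OF e, of c] by blast
    qed
    show "\<exists>x\<in>X. \<exists>y\<in>Y. present n f x y"
      if "X \<subseteq> {..<n}" "Y \<subseteq> {..<n}" "X \<inter> Y = {}" "card X = L" "card Y = L" for X Y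
    proof (rule ccontr)
      assume "\<not> ?thesis"
      then have "\<forall>x\<in>X. \<forall>y\<in>Y. \<not> present n f x y" by blast
      then show False using edge that by metis
    qed
    show "4 * card M < card (common_nbs (present n f) {..<n} S M)"
      if "S \<subseteq> {..<n}" "card S \<le> 3" "M \<subseteq> {..<n}" "M \<noteq> {}" "card M \<le> q" for S M
      using big [OF that] mult_right_mono [OF fac4, of "card M"] by linarith
    show "27 ^ 4 * L \<le> card (common_nbs (present n f) {..<n} S M)"
      if "S \<subseteq> {..<n}" "card S \<le> 3" "M \<subseteq> {..<n}" "card M = q" for S M
    proof -
      have "M \<noteq> {}" using that(4) q0 by auto
      then show ?thesis using big [OF that(1-3)] that(4) Lq by simp
    qed
  qed (use q0 L0 in auto)
  then show "\<exists>i<3. \<exists>j<3. \<exists>k<3. \<exists>a b d. \<forall>v\<in>verts ?G. mono_comp ?G c i v = a \<or> mono_comp ?G c j v = b \<or> mono_comp ?G c k v = d"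
    by simp
qed

lemma prob_tc_le_3: "1 - 2 / n \<le> measure_pmf.prob (gnp n p) {G. tc 3 G \<le> 3}"
proof -
  define B1 where "B1 = {f. \<exists>S M. S \<subseteq> {..<n} \<and> card S \<le> 3 \<and> M \<subseteq> {..<n} \<and> M \<noteq> {} \<and>
     card M \<le> q \<and> card (common_nbs (present n f) {..<n} S M) \<le> factor * card M}"
  define B2 where "B2 = {f. \<exists>X Y. X \<subseteq> {..<n} \<and> Y \<subseteq> {..<n} \<and> X \<inter> Y = {} \<and>
     card X = L \<and> card Y = L \<and> (\<forall>x\<in>X. \<forall>y\<in>Y. \<not> present n f x y)}"
  have "measure_pmf.prob (rand_edges n p) (B1 \<union> B2) \<le> 1 / n + 1 / n"
    using prob_not_expanding prob_no_edge_between_dense unfolding B1_def [symmetric] B2_def [symmetric]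
    by (intro order_trans [OF measure_Un_le]) auto
  then have "1 - 2 / n \<le> measure_pmf.prob (rand_edges n p) (UNIV - (B1 \<union> B2))"
    using measure_pmf.prob_compl [of "B1 \<union> B2" "rand_edges n p"] by simp
  also have "\<dots> \<le> measure_pmf.prob (rand_edges n p) {f. tc 3 ({..<n}, {e \<in> all_edges {..<n}. f e}) \<le> 3}"
  proof (intro measure_pmf.finite_measure_mono subsetI)
    fix f assume "f \<in> UNIV - (B1 \<union> B2)"
    then show "f \<in> {f. tc 3 ({..<n}, {e \<in> all_edges {..<n}. f e}) \<le> 3}"
      unfolding Diff_iff Un_iff de_Morgan_disj B1_def B2_def mem_Collect_eq
      by (elim conjE) (rule tc_le_3_if_expanding)
  qed simp
  also have "\<dots> = measure_pmf.prob (gnp n p) {G. tc 3 G \<le> 3}"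
    by (simp add: gnp_def vimage_def)
  finally show ?thesis .
qed

end

section \<open>Sparse random graphs\<close>

text \<open>In colour \<open>i\<close>, a vertex not adjacent to vertex number \<open>k\<close> of the quadruple is put into the component
  of vertex number \<open>omit_label k i\<close>.\<close>

definition omit_label :: "nat \<Rightarrow> nat \<Rightarrow> nat" where
  "omit_label k i = ([[2, 1, 3], [0, 2, 3], [0, 1, 3], [0, 1, 2]] ! k) ! i"

text \<open>Adjacent vertices outside the quadruple may miss any two of its members, and their edge
  still needs a colour; hence any two rows of the table agree somewhere.\<close>

lemma omit_labels_agree: "k < 4 \<Longrightarrow> m < 4 \<Longrightarrow> \<exists>i<3. omit_label k i = omit_label m i"
  unfolding less_4_cases ex_less_3 by (elim disjE) (simp_all add: omit_label_def)

text \<open>A vertex missing number \<open>k\<close> may be joined to all three others, so row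
  \<open>k\<close> lists each of them, one per colour.\<close>

lemma omit_label_covers: "k < 4 \<Longrightarrow> j < 4 \<Longrightarrow> j \<noteq> k \<Longrightarrow> \<exists>i<3. omit_label k i = j"
  unfolding less_4_cases ex_less_3 by (elim disjE) (simp_all add: omit_label_def)

lemma not_tc_le_3_if_quadruple:
  assumes fin: "finite V" and E: "E \<subseteq> all_edges V"
    and x: "inj_on x {..<4 :: nat}" "x ` {..<4} \<subseteq> V"
    and indep: "\<And>j k. j < 4 \<Longrightarrow> k < 4 \<Longrightarrow> {x j, x k} \<notin> E"
    and no_common: "\<And>v. v \<in> V \<Longrightarrow> \<exists>j<4. {x j, v} \<notin> E"
  shows "\<not> tc 3 (V, E) \<le> 3"
proof -
  define om where "om v = (SOME j. j < 4 \<and> {x j, v} \<notin> E)" for v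
  have om: "om v < 4" "{x (om v), v} \<notin> E" if "v \<in> V" for v
    using someI_ex [OF no_common [OF that, unfolded Bex_def]] unfolding om_def by auto
  define l where "l i v = (if v \<in> x ` {..<4} then inv_into {..<4} x v else omit_label (om v) i)" for i v
  have lx: "l i (x j) = j" if "j < 4" for i j using that x(1) by (simp add: l_def)
  \<comment> \<open>Any colour in which the ends have equal labels will do. Quantifying over the
    members of \<open>e\<close> avoids choosing an order of the ends.\<close>
  define c where "c e = (SOME i. i < 3 \<and> (\<forall>u\<in>e. \<forall>v\<in>e. l i u = l i v))" for e
  have outside: "\<exists>i<3. l i u = l i v" if uv: "{u, v} \<in> E" "v \<notin> x ` {..<4}" for u v
  proof -
    have V: "u \<in> V" "v \<in> V" using uv E by (auto simp: all_edges_def)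
    show ?thesis
    proof (cases "u \<in> x ` {..<4}")
      case True
      then obtain j where j: "j < 4" "u = x j" by auto
      then have "j \<noteq> om v" using om(2) [OF V(2)] uv by auto
      then show ?thesis using omit_label_covers [OF om(1) [OF V(2)] j(1)] lx [OF j(1)] j(2) uv(2)
        by (auto simp: l_def)
    next
      case False
      then show ?thesis using omit_labels_agree [OF om(1) [OF V(1)] om(1) [OF V(2)]] uv(2) by (simp add: l_def)
    qed
  qed
  have agree: "\<exists>i<3. \<forall>u\<in>e. \<forall>v\<in>e. l i u = l i v" if e: "e \<in> E" for e
  proof -
    obtain u v where uv: "e = {u, v}" using e E unfolding all_edges_def by (auto simp: card_2_iff)
    have "\<not> (u \<in> x ` {..<4} \<and> v \<in> x ` {..<4})" using indep e uv by auto
    then have "\<exists>i<3. l i u = l i v"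
      using outside [of u v] outside [of v u] e uv by (metis insert_commute)
    then show ?thesis unfolding uv by auto
  qed
  have c: "c e < 3 \<and> (\<forall>u\<in>e. \<forall>v\<in>e. l (c e) u = l (c e) v)" if "e \<in> E" for e
    unfolding c_def by (rule someI_ex [OF agree [OF that]])
  show ?thesis
  proof (rule not_tc_le [where c = c and l = l and X = "x ` {..<4}"])
    show "edge_colouring 3 (V, E) c" using c by (simp add: edge_colouring_def)
    show "l (c {u, v}) u = l (c {u, v}) v" if "{u, v} \<in> edges (V, E)" for u v using c that by simp
    show "3 < card (x ` {..<4})" using x(1) by (simp add: card_image)
    show "inj_on (l i) (x ` {..<4})" for i using lx by (auto simp: inj_on_def)
  qed (use fin x in auto)
qed

text \<open>The first \<open>4 * k\<close> vertices form \<open>k\<close> quadruples. Either some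
  edge lies among these vertices (\<open>B1\<close>), or each quadruple has a common neighbour among
  the remaining vertices (\<open>B2\<close>), or a suitable quadruple exists: outside
  \<open>B1\<close>, none of the first \<open>4 * k\<close> vertices is a common neighbour. The
  events that make up \<open>B2\<close> read disjoint edge sets, so their probabilities
  multiply.\<close>

lemma prob_not_tc_le_3:
  assumes p: "0 \<le> p" "p \<le> 1" and k: "4 * k \<le> n"
  shows "1 - ((4 * k)^2 * p + (1 - (1 - p ^ 4) ^ n) ^ k) \<le> measure_pmf.prob (gnp n p) {G. \<not> tc 3 G \<le> 3}"
proof -
  let ?D = "all_edges {..<n}" and ?A = "all_edges {..<4 * k}"
  have finD: "finite ?D" "finite ?A" by (simp_all add: finite_all_edges)
  have AD: "?A \<subseteq> ?D" using k by (auto simp: all_edges_def)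
  define B1 where "B1 = (\<Union>e\<in>?A. {f :: nat set \<Rightarrow> bool. f e})"
  define bad where "bad i f \<longleftrightarrow> (\<exists>v\<in>{4 * k..<n}. \<forall>j<4. f {4 * i + j, v})" for i :: nat and f :: "nat set \<Rightarrow> bool"
  define B2 where "B2 = {f. \<forall>i\<in>{..<k}. bad i f}"
  have "measure_pmf.prob (rand_edges n p) B1 \<le> (\<Sum>e\<in>?A. p)"
    unfolding B1_def
  proof (rule prob_UN_le_sum [OF finD(2)])
    show "measure_pmf.prob (rand_edges n p) {f. f e} \<le> p" if "e \<in> ?A" for e
      using prob_all_edges_in(1) [of "{e}" n p] that AD p by auto
  qed
  also have "\<dots> \<le> (4 * k)^2 * p"
  proof -
    have "card ?A \<le> (4 * k)^2"
      using card_subsets_le [of "{..<4 * k}" 2] by (simp add: all_edges_def)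
    then have "real (card ?A) \<le> real ((4 * k)^2)" by (simp only: of_nat_le_iff)
    then show ?thesis using p by (simp add: mult_right_mono)
  qed
  finally have B1: "measure_pmf.prob (rand_edges n p) B1 \<le> (4 * k)^2 * p" by simp
  let ?W = "\<lambda>i v. (\<lambda>j. {4 * i + j, v}) ` {..<4}"
  have prob_bad: "measure_pmf.prob (rand_edges n p) {f. bad i f} \<le> 1 - (1 - p ^ 4) ^ n" if i: "i < k" for i
  proof -
    have W: "?W i v \<subseteq> ?D" "card (?W i v) = 4" if v: "v \<in> {4 * k..<n}" for v
    proof -
      show "?W i v \<subseteq> ?D" using i v by (auto simp: pair_in_all_edges)
      have "inj_on (\<lambda>j. {4 * i + j, v}) {..<4}" using i v by (auto simp: inj_on_def doubleton_eq_iff)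
      then show "card (?W i v) = 4" by (simp add: card_image)
    qed
    have one: "measure_pmf.prob (rand_edges n p) {f. \<not> (\<forall>j<4. f {4 * i + j, v})} = 1 - p ^ 4"
      if v: "v \<in> {4 * k..<n}" for v
    proof -
      have "{f. \<forall>j<4. f {4 * i + j, v}} = {f. \<forall>e\<in>?W i v. f e}" by auto
      then have "measure_pmf.prob (rand_edges n p) {f. \<forall>j<4. f {4 * i + j, v}} = p ^ 4"
        using prob_all_edges_in(1) [OF W(1) [OF v] p] W(2) [OF v] by metis
      then show ?thesis
        using measure_pmf.prob_compl [of "{f. \<forall>j<4. f {4 * i + j, v}}" "rand_edges n p"]
        by (simp only: Compl_eq_Diff_UNIV [symmetric] Collect_neg_eq [symmetric] space_measure_pmf sets_measure_pmf UNIV_I)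
    qed
    have "measure_pmf.prob (rand_edges n p) {f. \<forall>v\<in>{4 * k..<n}. \<not> (\<forall>j<4. f {4 * i + j, v})} =
        (\<Prod>v\<in>{4 * k..<n}. measure_pmf.prob (rand_edges n p) {f. \<not> (\<forall>j<4. f {4 * i + j, v})})"
    proof (rule prob_Pi_pmf_all [OF finD(1), where B = "?W i"])
      show "disjoint_family_on (?W i) {4 * k..<n}"
        using i by (auto simp: disjoint_family_on_def doubleton_eq_iff)
      show "depends_on (\<lambda>f. \<not> (\<forall>j<4. f {4 * i + j, v})) (?W i v)" for v by (auto simp: depends_on_def)
    qed (use W in auto)
    also have "\<dots> = (1 - p ^ 4) ^ (n - 4 * k)" using one by simp
    also have "\<dots> \<ge> (1 - p ^ 4) ^ n" using p power_le_one [OF p, of 4] by (intro power_decreasing) auto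
    finally have *: "(1 - p ^ 4) ^ n \<le> measure_pmf.prob (rand_edges n p) {f. \<not> bad i f}"
      by (simp add: bad_def)
    have "measure_pmf.prob (rand_edges n p) {f. \<not> bad i f} = 1 - measure_pmf.prob (rand_edges n p) {f. bad i f}"
      using measure_pmf.prob_compl [of "{f. bad i f}" "rand_edges n p"]
      by (simp add: Compl_eq_Diff_UNIV [symmetric] Collect_neg_eq [symmetric])
    then show ?thesis using * by linarith
  qed
  have "measure_pmf.prob (rand_edges n p) B2 = (\<Prod>i\<in>{..<k}. measure_pmf.prob (rand_edges n p) {f. bad i f})"
    unfolding B2_def
  proof (rule prob_Pi_pmf_all [OF finD(1), where B = "\<lambda>i. \<Union>v\<in>{4 * k..<n}. ?W i v"])
    show "(\<Union>v\<in>{4 * k..<n}. ?W i v) \<subseteq> ?D" if "i \<in> {..<k}" for i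
      using that by (auto simp: pair_in_all_edges)
    show "disjoint_family_on (\<lambda>i. \<Union>v\<in>{4 * k..<n}. ?W i v) {..<k}"
    proof (unfold disjoint_family_on_def, intro ballI impI)
      fix i i' assume "i \<in> {..<k}" "i' \<in> {..<k}" "i \<noteq> i'"
      then show "(\<Union>v\<in>{4 * k..<n}. ?W i v) \<inter> (\<Union>v\<in>{4 * k..<n}. ?W i' v) = {}"
        by (auto simp: doubleton_eq_iff)
    qed
    show "depends_on (bad i) (\<Union>v\<in>{4 * k..<n}. ?W i v)" for i
      unfolding depends_on_def bad_def by (intro allI impI bex_cong refl) auto
  qed simp
  also have "\<dots> \<le> (\<Prod>i\<in>{..<k}. 1 - (1 - p ^ 4) ^ n)" using prob_bad by (intro prod_mono) auto
  finally have B2: "measure_pmf.prob (rand_edges n p) B2 \<le> (1 - (1 - p ^ 4) ^ n) ^ k" by simp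
  have "measure_pmf.prob (rand_edges n p) (B1 \<union> B2) \<le> (4 * k)^2 * p + (1 - (1 - p ^ 4) ^ n) ^ k"
    using B1 B2 by (intro order_trans [OF measure_Un_le]) auto
  then have "1 - ((4 * k)^2 * p + (1 - (1 - p ^ 4) ^ n) ^ k) \<le> measure_pmf.prob (rand_edges n p) (UNIV - (B1 \<union> B2))"
    using measure_pmf.prob_compl [of "B1 \<union> B2" "rand_edges n p"] by simp
  also have "\<dots> \<le> measure_pmf.prob (rand_edges n p) {f. \<not> tc 3 ({..<n}, {e \<in> ?D. f e}) \<le> 3}"
  proof (intro measure_pmf.finite_measure_mono subsetI)
    fix f assume "f \<in> UNIV - (B1 \<union> B2)"
    then have f1: "\<And>e. e \<in> ?A \<Longrightarrow> \<not> f e" and "\<exists>i<k. \<not> bad i f" by (auto simp: B1_def B2_def)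
    then obtain i where i: "i < k" "\<not> bad i f" by blast
    have "\<not> tc 3 ({..<n}, {e \<in> ?D. f e}) \<le> 3"
    proof (rule not_tc_le_3_if_quadruple [where x = "\<lambda>j. 4 * i + j"])
      show "{4 * i + a, 4 * i + b} \<notin> {e \<in> ?D. f e}" if "a < 4" "b < 4" for a b
        using f1 [of "{4 * i + a, 4 * i + b}"] i(1) that by (auto simp: pair_in_all_edges)
      show "\<exists>j<4. {4 * i + j, v} \<notin> {e \<in> ?D. f e}" if "v \<in> {..<n}" for v
      proof (cases "v < 4 * k")
        case True
        then have "{4 * i + 0, v} \<notin> {e \<in> ?D. f e}"
          using f1 [of "{4 * i + 0, v}"] i(1) by (auto simp: pair_in_all_edges)
        then show ?thesis by (intro exI [of _ 0]) auto
      next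
        case False
        then show ?thesis using i(2) that by (auto simp: bad_def not_less)
      qed
    qed (use i k in \<open>auto simp: inj_on_def\<close>)
    then show "f \<in> {f. \<not> tc 3 ({..<n}, {e \<in> ?D. f e}) \<le> 3}" by simp
  qed simp
  also have "\<dots> = measure_pmf.prob (gnp n p) {G. \<not> tc 3 G \<le> 3}"
    by (simp add: gnp_def vimage_def)
  finally show ?thesis by simp
qed

section \<open>The threshold\<close>

lemma pstar_power4:
  assumes "1 < n"
  shows "((ln (real n) / real n) powr (1 / 4)) ^ 4 = ln (real n) / real n"
proof -
  have "0 < ln (real n) / real n" using assms by simp
  then have "((ln (real n) / real n) powr (1 / 4)) ^ 4 = (ln (real n) / real n) powr (of_nat 4 * (1 / 4))"
    using \<open>0 < _\<close> by (intro powr_power) (rule less_imp_neq [symmetric])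
  then show ?thesis using assms by simp
qed

lemma exp_le_one_minus:
  fixes y :: real
  assumes "0 \<le> y" "y \<le> 1 / 2"
  shows "exp (- (2 * y)) \<le> 1 - y"
proof -
  have "y * y \<le> y * (1 / 2)" using assms by (intro mult_left_mono) auto
  then have "- (2 * y) \<le> ln (1 - y)"
    using ln_one_minus_pos_lower_bound [OF assms] by (simp add: power2_eq_square)
  then show ?thesis using assms by (simp add: ln_ge_iff)
qed

text \<open>Here \<open>n * p ^ 4 <= ln n / 256\<close>, so a quadruple lacks a common neighbour
  with probability at least \<open>(1 - p ^ 4) ^ n >= n powr (- 1 / 128)\<close>, a factor 2 in the
  exponent being lost in \<open>exp_le_one_minus\<close>. The exponent \<open>1 / 16\<close> of
  \<open>k\<close> lies above \<open>1 / 128\<close>, so that some quadruple succeeds, and below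
  \<open>1 / 8\<close>, so that \<open>k ^ 2 * p\<close> tends to 0.\<close>

lemma prob_not_tc_le_3_sparse:
  fixes n :: nat and p :: real
  defines "k \<equiv> nat \<lfloor>real n powr (1 / 16)\<rfloor>"
  assumes n: "12 \<le> n" and k: "4 * k \<le> n"
    and p: "0 \<le> p" "p \<le> 1" and sparse: "p < 1 / 4 * (ln n / n) powr (1 / 4)"
  shows "1 - (4 * real n powr (1 / 8) * (ln n / n) powr (1 / 4) + exp (- (real n powr (1 / 16) - 1) * real n powr (- 1 / 128)))
    \<le> measure_pmf.prob (gnp n p) {G. \<not> tc 3 G \<le> 3}"
proof -
  let ?x = "(ln n / n) powr (1 / 4)"
  have kr: "real k \<le> real n powr (1 / 16)" "real n powr (1 / 16) - 1 \<le> real k"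
    unfolding k_def using powr_ge_zero [of "real n" "1 / 16"] by linarith+
  have "(real k)^2 \<le> (real n powr (1 / 16))^2" using kr by (intro power_mono) auto
  also have "\<dots> = real n powr (1 / 8)" using n powr_power [of "real n" "1 / 16" 2] by simp
  finally have "16 * (real k)^2 * p \<le> 16 * real n powr (1 / 8) * (1 / 4 * ?x)"
    using sparse p by (intro mult_mono) auto
  then have first: "16 * (real k)^2 * p \<le> 4 * real n powr (1 / 8) * ?x" by linarith
  have "p ^ 4 \<le> (1 / 4 * ?x) ^ 4" using p sparse by (intro power_mono) auto
  also have "\<dots> = ln n / (256 * n)" using pstar_power4 [of n] n by (simp add: power_mult_distrib power_divide)
  finally have p4: "p ^ 4 \<le> ln n / (256 * n)" .
  have "ln n \<le> n" using n ln_le_minus_one [of "real n"] by simp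
  then have "ln n / (256 * n) \<le> 1 / 2" using n by (simp add: field_simps)
  then have p4': "p ^ 4 \<le> 1 / 2" using p4 by linarith
  have "real n powr (- 1 / 128) = exp (- (ln n / 128))" using n by (simp add: powr_def)
  also have "\<dots> \<le> exp (real n * - (2 * p ^ 4))"
    using mult_left_mono [OF p4, of "2 * real n"] n by (simp add: field_simps)
  also have "\<dots> = exp (- (2 * p ^ 4)) ^ n" by (rule exp_of_nat_mult)
  also have "\<dots> \<le> (1 - p ^ 4) ^ n" using exp_le_one_minus [OF _ p4'] p by (intro power_mono) auto
  finally have lower: "real n powr (- 1 / 128) \<le> (1 - p ^ 4) ^ n" .
  have le1: "(1 - p ^ 4) ^ n \<le> 1" using p p4' by (intro power_le_one) auto
  have "(1 - (1 - p ^ 4) ^ n) ^ k \<le> exp (- (real n powr (- 1 / 128))) ^ k"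
  proof (intro power_mono)
    show "1 - (1 - p ^ 4) ^ n \<le> exp (- (real n powr (- 1 / 128)))"
      using lower exp_ge_add_one_self [of "- (real n powr (- 1 / 128))"] by linarith
  qed (use le1 in simp)
  also have "\<dots> = exp (real k * - (real n powr (- 1 / 128)))" by (rule exp_of_nat_mult [symmetric])
  also have "\<dots> \<le> exp (- (real n powr (1 / 16) - 1) * real n powr (- 1 / 128))"
    using mult_right_mono [OF kr(2), of "real n powr (- 1 / 128)"] by (simp add: algebra_simps)
  finally have second: "(1 - (1 - p ^ 4) ^ n) ^ k \<le> exp (- (real n powr (1 / 16) - 1) * real n powr (- 1 / 128))" .
  have "1 - (16 * (real k)^2 * p + (1 - (1 - p ^ 4) ^ n) ^ k) \<le> measure_pmf.prob (gnp n p) {G. \<not> tc 3 G \<le> 3}"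
    using prob_not_tc_le_3 [OF p k] by (simp add: power_mult_distrib)
  then show ?thesis using first second by linarith
qed

theorem theorem1p1:
  "is_threshold (\<lambda>G. tc 3 G \<le> 3) (\<lambda>n. (ln (real n) / real n) powr (1 / 4))"
  unfolding is_threshold_def
\<comment> \<open>\<open>100 ^ 4\<close> is the constant of \<open>dense_regime\<close>, and
  \<open>(1 / 4) ^ 4 = 1 / 256\<close> is behind the exponent \<open>1 / 128\<close> of the sparse
  case.\<close>
proof (rule exI [of _ 100], rule conjI, simp, rule exI [of _ "1 / 4"], intro conjI allI impI)
  fix p :: "nat \<Rightarrow> real" assume p: "\<forall>n. 0 \<le> p n \<and> p n \<le> 1"
  assume "\<forall>\<^sub>F n in sequentially. 100 * (ln (real n) / real n) powr (1 / 4) < p n"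
  then have lower: "\<forall>\<^sub>F n in sequentially. 1 - 2 / n \<le> measure_pmf.prob (gnp n (p n)) {G. tc 3 G \<le> 3}"
    using eventually_ge_at_top [of 12]
  proof eventually_elim
    case (elim n)
    have "(100 * (ln (real n) / real n) powr (1 / 4)) ^ 4 \<le> p n ^ 4" using elim by (intro power_mono) auto
    then have "100000000 * (ln (real n) / real n) \<le> p n ^ 4"
      using pstar_power4 [of n] elim by (simp add: power_mult_distrib)
    then have "100000000 * ln n \<le> n * p n ^ 4" using elim by (simp add: field_simps)
    moreover have "0 < p n" using elim by (intro le_less_trans [OF _ elim(1)]) simp
    ultimately interpret dense_regime n "p n" using elim p by unfold_locales auto
    show ?case by (rule prob_tc_le_3)
  qed
  have upper: "\<forall>\<^sub>F n in sequentially. measure_pmf.prob (gnp n (p n)) {G. tc 3 G \<le> 3} \<le> 1"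
    by (simp add: always_eventually)
  have "(\<lambda>n. 1 - 2 / real n) \<longlonglongrightarrow> 1" by real_asymp
  from tendsto_sandwich [OF lower upper this tendsto_const]
  show "whp_gnp p (\<lambda>G. tc 3 G \<le> 3)" unfolding whp_gnp_def .
next
  fix p :: "nat \<Rightarrow> real" assume p: "\<forall>n. 0 \<le> p n \<and> p n \<le> 1"
  assume sparse: "\<forall>\<^sub>F n in sequentially. p n < 1 / 4 * (ln (real n) / real n) powr (1 / 4)"
  let ?err = "\<lambda>n. 4 * real n powr (1 / 8) * (ln n / n) powr (1 / 4) + exp (- (real n powr (1 / 16) - 1) * real n powr (- 1 / 128))"
  have "\<forall>\<^sub>F n in sequentially. 4 * real n powr (1 / 16) \<le> real n" by real_asymp
  then have lower: "\<forall>\<^sub>F n in sequentially. 1 - ?err n \<le> measure_pmf.prob (gnp n (p n)) {G. \<not> tc 3 G \<le> 3}"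
    using eventually_ge_at_top [of 12] sparse
  proof eventually_elim
    case (elim n)
    have "4 * nat \<lfloor>real n powr (1 / 16)\<rfloor> \<le> n" using elim(1) by linarith
    then show ?case using prob_not_tc_le_3_sparse [OF elim(2)] p elim(3) by blast
  qed
  have upper: "\<forall>\<^sub>F n in sequentially. measure_pmf.prob (gnp n (p n)) {G. \<not> tc 3 G \<le> 3} \<le> 1"
    by (simp add: always_eventually)
  \<comment> \<open>Both error terms vanish because \<open>1 / 8 < 1 / 4\<close> and
    \<open>1 / 128 < 1 / 16\<close>.\<close>
  have "(\<lambda>n. 1 - ?err n) \<longlonglongrightarrow> 1" by real_asymp
  from tendsto_sandwich [OF lower upper this tendsto_const]
  show "whp_gnp p (\<lambda>G. \<not> tc 3 G \<le> 3)" unfolding whp_gnp_def .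
qed simp

end
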